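(* Let $b\ge0$, $p\ge4$ and $\omega>0$ be fixed. For $c$ with $4\omega>c^2$, let $\varphi_{\omega,c}\in H^1(\mathbb{R})$ be the positive, even solution of $$-\varphi_{xx}+\left(\omega-\tfrac{c^2}{4}\right)\varphi+\tfrac{c}{2}|\varphi|^2\varphi-\tfrac{3}{16}|\varphi|^4\varphi-b|\varphi|^p\varphi=0$$ and let $$\phi_{\omega,c}(x)=\varphi_{\omega,c}(x)\exp\left(\tfrac{c}{2}ix-\tfrac{i}{4}\int_{-\infty}^x|\varphi_{\omega,c}(y)|^2\,dy\right).$$ Then $$\|\phi_{\omega,c}\|_{H^1(\mathbb{R})}\to0\quad\text{when } c\to-2\sqrt{\omega}.$$
   Context: The limit is taken over $c\in(-2\sqrt{\omega},2\sqrt{\omega})$ with $b$, $p$, $\omega$ fixed. For such parameters the positive, even $H^1(\mathbb{R})$ solution $\varphi_{\omega,c}$ exists and is unique. *)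

theory Defs
  imports "HOL-Analysis.Analysis"
begin

definition test_function :: "(real \<Rightarrow> real) \<Rightarrow> bool" where
  "test_function \<psi> \<longleftrightarrow>
     (\<forall>n. (deriv ^^ n) \<psi> differentiable_on UNIV) \<and> compact (closure {x. \<psi> x \<noteq> 0})"

definition locally_integrable :: "(real \<Rightarrow> 'a::euclidean_space) \<Rightarrow> bool" where
  "locally_integrable f \<longleftrightarrow> (\<forall>K. compact K \<longrightarrow> set_integrable lborel K f)"

definition has_weak_deriv ::
    "(real \<Rightarrow> 'a::euclidean_space) \<Rightarrow> (real \<Rightarrow> 'a) \<Rightarrow> bool" where
  "has_weak_deriv f g \<longleftrightarrow> locally_integrable f \<and> locally_integrable g \<and>
     (\<forall>\<psi>. test_function \<psi> \<longrightarrow>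
        (LINT x|lborel. deriv \<psi> x *\<^sub>R f x) = - (LINT x|lborel. \<psi> x *\<^sub>R g x))"

(* The weak derivative is unique only up to null sets; weak_deriv picks a representative. *)
definition weak_deriv :: "(real \<Rightarrow> 'a::euclidean_space) \<Rightarrow> real \<Rightarrow> 'a" where
  "weak_deriv f = (SOME g. has_weak_deriv f g)"

definition square_integrable :: "(real \<Rightarrow> 'a::euclidean_space) \<Rightarrow> bool" where
  "square_integrable f \<longleftrightarrow>
     f \<in> borel_measurable lborel \<and> integrable lborel (\<lambda>x. (norm (f x))\<^sup>2)"

(* Elements of H^1(R) are represented by functions, to be read modulo null sets. *)
definition H1 :: "(real \<Rightarrow> 'a::euclidean_space) set" where
  "H1 = {f. square_integrable f \<and> (\<exists>g. has_weak_deriv f g \<and> square_integrable g)}"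

(* Meaningful only on H1: outside H1 this real number is a default value. *)
definition H1_norm :: "(real \<Rightarrow> 'a::euclidean_space) \<Rightarrow> real" where
  "H1_norm f =
     sqrt ((LINT x|lborel. (norm (f x))\<^sup>2) + (LINT x|lborel. (norm (weak_deriv f x))\<^sup>2))"

(* The equation is that of an H^1 solution: the second derivative is a weak one and the
   equation holds almost everywhere. Positivity and evenness hold almost everywhere as well,
   so that nothing depends on the representative of the class in H^1. *)
definition positive_even_profile ::
    "real \<Rightarrow> real \<Rightarrow> real \<Rightarrow> real \<Rightarrow> (real \<Rightarrow> real) \<Rightarrow> bool" where
  "positive_even_profile b p \<omega> c \<phi> \<longleftrightarrow>
     \<phi> \<in> H1 \<and>
     (AE x in lborel. 0 < \<phi> x) \<and>
     (AE x in lborel. \<phi> (- x) = \<phi> x) \<and>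
     (\<exists>\<phi>\<^sub>x \<phi>\<^sub>x\<^sub>x. has_weak_deriv \<phi> \<phi>\<^sub>x \<and> has_weak_deriv \<phi>\<^sub>x \<phi>\<^sub>x\<^sub>x \<and>
        (AE x in lborel.
           - \<phi>\<^sub>x\<^sub>x x + (\<omega> - c\<^sup>2 / 4) * \<phi> x + c / 2 * \<bar>\<phi> x\<bar>\<^sup>2 * \<phi> x
             - 3 / 16 * \<bar>\<phi> x\<bar> ^ 4 * \<phi> x - b * \<bar>\<phi> x\<bar> powr p * \<phi> x = 0))"

definition gauged_profile :: "real \<Rightarrow> (real \<Rightarrow> real) \<Rightarrow> real \<Rightarrow> complex" where
  "gauged_profile c \<phi> x =
     complex_of_real (\<phi> x) *
       exp (complex_of_real (c / 2) * \<i> * complex_of_real x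
            - \<i> / 4 * complex_of_real (LINT y:{..x}|lborel. \<bar>\<phi> y\<bar>\<^sup>2))"

end

theory Submission
  imports Defs
begin

text \<open>
  Write $a = \omega - c^2/4$, which tends to $0$ as $c \to -2\sqrt\omega$. For $c$ near this end point
  the cubic term is focusing, and everything follows from two facts about the profile $u$.
  The energy identity (\<open>energy\<close>)
  \[ u'^2 = a u^2 + \tfrac{c}{4} u^4 - \tfrac{1}{16} u^6 - \tfrac{2b}{p+2} u^{p+2} \]
  has, for negative $c$, only nonpositive terms besides $a u^2$. Hence $|u'| \le \sqrt a\, u$, which
  makes $u$ positive everywhere, and $u^2 \le 4a/|c|$. Moreover, the logarithmic derivative
  $w = u'/u$ satisfies $|w| \le \sqrt a$ and $w' \le -\frac{|c|}{4} u^2$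
  (\<open>log_deriv_has_derivative_le\<close>); integrating this inequality over the line gives the explicit bound
  $\int u^2 \le 8\sqrt a/|c|$ (\<open>mass_le\<close>).

  The gauged profile is $u\,e^{i\theta}$ with $\theta' = c/2 - u^2/4$, so its squared $H^1$ norm is the
  integral of $u^2 + u'^2 + u^2\theta'^2$ (\<open>gauged_profile_H1\<close>), and the pointwise bounds turn
  this into a bounded multiple of $\int u^2$ (\<open>H1_mass_le\<close>). It therefore tends to $0$ like
  $\sqrt a$.

  The analysis above needs a classical solution. A weak derivative is unique almost everywhere
  by the fundamental lemma of the calculus of variations, and a function with a weak derivative
  is almost everywhere a constant plus a primitive of it, by the du Bois-Reymond lemma
  (\<open>weak_deriv_AE_primitive\<close>). Applied twice, this turns the almost-everywhere equation into
  $u'' = N(u)$ with a twice differentiable $u$ (\<open>weak_second_order_solution_classical\<close>). Both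
  lemmas rest on test functions built from $e^{-1/x}$.
\<close>

section \<open>Smooth bumps\<close>

text \<open>A recursion on the number of derivatives, so that closure under sums, products and
  affine substitutions follows by induction; requiring every \<open>n\<close> gives smoothness.\<close>

primrec times_differentiable :: "nat \<Rightarrow> (real \<Rightarrow> real) \<Rightarrow> bool" where
  "times_differentiable 0 f \<longleftrightarrow> True"
| "times_differentiable (Suc n) f \<longleftrightarrow>
     f differentiable_on UNIV \<and> times_differentiable n (deriv f)"

lemma all_derivs_differentiable_iff:
  "(\<forall>n. (deriv ^^ n) f differentiable_on UNIV) \<longleftrightarrow> (\<forall>n. times_differentiable n f)"
proof -
  have "times_differentiable n f \<longleftrightarrow> (\<forall>k<n. (deriv ^^ k) f differentiable_on UNIV)" for n
  proof (induction n arbitrary: f)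
    case (Suc n)
    have "(\<forall>k<Suc n. (deriv ^^ k) f differentiable_on UNIV) \<longleftrightarrow>
      f differentiable_on UNIV \<and> (\<forall>k<n. (deriv ^^ k) (deriv f) differentiable_on UNIV)"
      by (simp only: All_less_Suc2 funpow_0 funpow_Suc_right o_apply)
    with Suc show ?case by simp
  qed simp
  then show ?thesis by (metis lessI)
qed

text \<open>Naming the derivative by an explicit function avoids computing with
  \<^const>\<open>deriv\<close>.\<close>

lemma times_differentiable_Suc_iff:
  "times_differentiable (Suc n) f \<longleftrightarrow>
     (\<exists>f'. (\<forall>x. (f has_real_derivative f' x) (at x)) \<and> times_differentiable n f')"
proof
  assume "times_differentiable (Suc n) f"
  then show "\<exists>f'. (\<forall>x. (f has_real_derivative f' x) (at x)) \<and> times_differentiable n f'"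
    by (intro exI[of _ "deriv f"])
       (auto simp: differentiable_on_def DERIV_deriv_iff_real_differentiable)
next
  assume "\<exists>f'. (\<forall>x. (f has_real_derivative f' x) (at x)) \<and> times_differentiable n f'"
  then obtain f' where f': "\<And>x. (f has_real_derivative f' x) (at x)" "times_differentiable n f'"
    by blast
  have "deriv f = f'" using f'(1) DERIV_imp_deriv by blast
  then show "times_differentiable (Suc n) f" using f'
    by (auto simp: differentiable_on_def real_differentiable_def)
qed

declare times_differentiable.simps(2) [simp del]

lemma times_differentiable_SucD: "times_differentiable (Suc n) f \<Longrightarrow> times_differentiable n f"
  by (induction n arbitrary: f) (auto simp: times_differentiable.simps(2))

lemma times_differentiable_const: "times_differentiable n (\<lambda>_. c)"
proof (induction n arbitrary: c)
  case (Suc n)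
  show ?case unfolding times_differentiable_Suc_iff
    by (intro exI[of _ "\<lambda>_. 0"] conjI allI DERIV_const Suc.IH)
qed simp

lemma times_differentiable_add:
  "times_differentiable n f \<Longrightarrow> times_differentiable n g \<Longrightarrow> times_differentiable n (\<lambda>x. f x + g x)"
proof (induction n arbitrary: f g)
  case (Suc n)
  from Suc.prems obtain f' g' where
    f': "\<And>x. (f has_real_derivative f' x) (at x)" "times_differentiable n f'" and
    g': "\<And>x. (g has_real_derivative g' x) (at x)" "times_differentiable n g'"
    unfolding times_differentiable_Suc_iff by blast
  then show ?case unfolding times_differentiable_Suc_iff
    by (intro exI[of _ "\<lambda>x. f' x + g' x"] conjI allI DERIV_add Suc.IH) auto
qed simp

lemma times_differentiable_mult:
  "times_differentiable n f \<Longrightarrow> times_differentiable n g \<Longrightarrow> times_differentiable n (\<lambda>x. f x * g x)"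
proof (induction n arbitrary: f g)
  case (Suc n)
  note low = Suc.prems[THEN times_differentiable_SucD]
  from Suc.prems obtain f' g' where
    f': "\<And>x. (f has_real_derivative f' x) (at x)" "times_differentiable n f'" and
    g': "\<And>x. (g has_real_derivative g' x) (at x)" "times_differentiable n g'"
    unfolding times_differentiable_Suc_iff by blast
  have "((\<lambda>x. f x * g x) has_real_derivative f' x * g x + g' x * f x) (at x)" for x
    by (rule DERIV_mult[OF f'(1) g'(1)])
  moreover have "times_differentiable n (\<lambda>x. f' x * g x + g' x * f x)"
    by (intro times_differentiable_add Suc.IH f' g' low)
  ultimately show ?case unfolding times_differentiable_Suc_iff
    by (intro exI[of _ "\<lambda>x. f' x * g x + g' x * f x"] conjI allI)
qed simp

lemma times_differentiable_affine:
  "times_differentiable n f \<Longrightarrow> times_differentiable n (\<lambda>x. f (k * x + m))"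
proof (induction n arbitrary: f)
  case (Suc n)
  then obtain f' where
    f': "\<And>x. (f has_real_derivative f' x) (at x)" "times_differentiable n f'"
    unfolding times_differentiable_Suc_iff by blast
  have "((\<lambda>x. f (k * x + m)) has_real_derivative k * f' (k * x + m)) (at x)" for x
    by (rule DERIV_cong[OF DERIV_chain2[OF f'(1)]]) (auto intro!: derivative_eq_intros)
  moreover have "times_differentiable n (\<lambda>x. k * f' (k * x + m))"
    by (intro times_differentiable_mult times_differentiable_const Suc.IH f')
  ultimately show ?case unfolding times_differentiable_Suc_iff
    by (intro exI[of _ "\<lambda>x. k * f' (k * x + m)"] conjI allI)
qed simp

text \<open>The functions $P(1/x)\,e^{-1/x}$, extended by $0$ to $x \le 0$. Carrying the
  polynomial \<open>P\<close> along makes the family closed under differentiation, which is what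
  proves that $e^{-1/x}$ is smooth across the origin.\<close>

definition flat_exp :: "real poly \<Rightarrow> real \<Rightarrow> real" where
  "flat_exp P x = (if 0 < x then poly P (1 / x) * exp (- 1 / x) else 0)"

lemma poly_mult_exp_uminus_tendsto_0:
  "((\<lambda>y. poly P y * exp (- y)) \<longlongrightarrow> (0::real)) at_top"
proof -
  have "((\<lambda>y. \<Sum>i\<le>degree P. coeff P i * (y ^ i / exp y)) \<longlongrightarrow> (\<Sum>i\<le>degree P. coeff P i * 0)) at_top"
    by (intro tendsto_sum tendsto_mult tendsto_const tendsto_power_div_exp_0)
  then show ?thesis
    by (simp add: poly_altdef sum_distrib_right exp_minus divide_inverse mult.assoc)
qed

text \<open>Away from the origin this is the chain rule. At the origin the difference quotient
  from the right is again a polynomial in $y = 1/x$ times $e^{-y}$, hence tends to $0$.\<close>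

lemma flat_exp_has_derivative:
  "(flat_exp P has_real_derivative flat_exp ([:0, 0, 1:] * (P - pderiv P)) x) (at x)"
proof -
  consider "x < 0" | "0 < x" | "x = 0" by linarith
  then show ?thesis
  proof cases
    case 1
    have "((\<lambda>_. 0) has_real_derivative 0) (at x)" by simp
    then have "(flat_exp P has_real_derivative 0) (at x)"
      by (rule has_field_derivative_transform_within_open[where S="{..<0}"])
         (use 1 in \<open>auto simp: flat_exp_def\<close>)
    with 1 show ?thesis by (simp add: flat_exp_def)
  next
    case 2
    have "((\<lambda>x. poly P (1 / x) * exp (- 1 / x)) has_real_derivative
        flat_exp ([:0, 0, 1:] * (P - pderiv P)) x) (at x)"
      using 2 by (auto simp: flat_exp_def algebra_simps power2_eq_square divide_simps
          intro!: derivative_eq_intros DERIV_chain2[OF poly_DERIV])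
    then show ?thesis
      by (rule has_field_derivative_transform_within_open[where S="{0<..}"])
         (use 2 in \<open>auto simp: flat_exp_def\<close>)
  next
    case 3
    have "((\<lambda>h. flat_exp P h / h) \<longlongrightarrow> 0) (at_right 0)"
    proof -
      have "((\<lambda>h. poly (pCons 0 P) (1 / h) * exp (- (1 / h))) \<longlongrightarrow> (0::real)) (at_right 0)"
        by (rule filterlim_compose[OF poly_mult_exp_uminus_tendsto_0])
           (simp add: filterlim_inverse_at_top_right flip: inverse_eq_divide)
      then show ?thesis
        by (rule Lim_transform_eventually)
           (auto simp: eventually_at_filter flat_exp_def)
    qed
    moreover have "((\<lambda>h. flat_exp P h / h) \<longlongrightarrow> 0) (at_left 0)"
      by (rule Lim_transform_eventually[OF tendsto_const])
         (auto simp: eventually_at_filter flat_exp_def)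
    ultimately have "((\<lambda>h. flat_exp P h / h) \<longlongrightarrow> 0) (at 0)"
      by (simp add: filterlim_split_at_real)
    with 3 show ?thesis by (simp add: DERIV_def flat_exp_def)
  qed
qed

lemma times_differentiable_flat_exp: "times_differentiable n (flat_exp P)"
proof (induction n arbitrary: P)
  case (Suc n)
  then show ?case unfolding times_differentiable_Suc_iff using flat_exp_has_derivative by blast
qed simp

text \<open>With $h(t) = e^{-1/t}$ for positive $t$ and $0$ otherwise, this is $h(n(x-l))\,h(n(r-x))$.
  Since $h \le 1$ and $h(nt) \to 1$ for positive $t$, the bumps stay in $[0,1]$ and
  converge to the indicator of the open interval, which is all that dominated convergence
  requires.\<close>

definition bump :: "real \<Rightarrow> real \<Rightarrow> nat \<Rightarrow> real \<Rightarrow> real" where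
  "bump l r n x = flat_exp 1 (real n * (x - l)) * flat_exp 1 (real n * (r - x))"

lemma bump_outside: "x \<notin> {l..r} \<Longrightarrow> bump l r n x = 0"
  by (auto simp: bump_def flat_exp_def zero_less_mult_iff)

lemma bump_bounds: "0 \<le> bump l r n x" "bump l r n x \<le> 1"
  by (auto simp: bump_def flat_exp_def intro!: mult_le_one)

lemma test_functionI:
  assumes "\<And>n. times_differentiable n \<psi>" and "\<And>x. x \<notin> {l..r} \<Longrightarrow> \<psi> x = 0"
  shows "test_function \<psi>"
proof -
  have "closure {x. \<psi> x \<noteq> 0} \<subseteq> {l..r}"
    by (rule closure_minimal) (use assms(2) in blast)+
  then have "compact (closure {x. \<psi> x \<noteq> 0})"
    by (meson bounded_subset bounded_closed_interval closed_closure compact_eq_bounded_closed)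
  then show ?thesis using assms(1) by (simp add: test_function_def all_derivs_differentiable_iff)
qed

lemma test_function_bump: "test_function (bump l r n)"
proof (rule test_functionI[where l=l and r=r])
  fix k
  have "bump l r n = (\<lambda>x. flat_exp 1 (real n * x + - real n * l) * flat_exp 1 (- real n * x + real n * r))"
    by (simp add: bump_def fun_eq_iff algebra_simps)
  then show "times_differentiable k (bump l r n)"
    by (simp only:) (intro times_differentiable_mult times_differentiable_affine times_differentiable_flat_exp)
qed (rule bump_outside)

lemma bump_tendsto_indicator: "(\<lambda>n. bump l r n x) \<longlonglongrightarrow> indicator {l<..<r} x"
proof (cases "x \<in> {l<..<r}")
  case True
  have aux: "(\<lambda>n. flat_exp 1 (real n * d)) \<longlonglongrightarrow> 1" if "0 < d" for d
  proof -
    have "(\<lambda>n. exp (- (inverse d * inverse (real n)))) \<longlonglongrightarrow> exp (- (inverse d * 0))"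
      by (intro tendsto_intros lim_inverse_n)
    then have "(\<lambda>n. exp (- (inverse d * inverse (real n)))) \<longlonglongrightarrow> 1" by simp
    then show ?thesis
      by (rule Lim_transform_eventually)
         (use that in \<open>auto simp: flat_exp_def field_simps eventually_sequentially intro!: exI[of _ 1]\<close>)
  qed
  have "(\<lambda>n. flat_exp 1 (real n * (x - l)) * flat_exp 1 (real n * (r - x))) \<longlonglongrightarrow> 1 * 1"
    by (intro tendsto_mult aux) (use True in auto)
  then show ?thesis using True by (simp add: bump_def)
next
  case False
  then have "bump l r n x = 0" for n
    by (auto simp: bump_def flat_exp_def zero_less_mult_iff)
  with False show ?thesis by simp
qed


section \<open>Weak derivatives\<close>

lemma AE_imp_ex_in_interval:
  fixes l r :: real
  assumes "AE x in lborel. P x" "l < r"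
  obtains x where "l < x" "x < r" "P x"
proof -
  have "\<exists>x\<in>{l<..<r}. P x"
  proof (rule ccontr)
    assume none: "\<not> (\<exists>x\<in>{l<..<r}. P x)"
    have "AE x in lborel. x \<notin> {l<..<r}" using assms(1) by eventually_elim (use none in blast)
    then have "emeasure lborel {l<..<r} = 0"
      by (subst (asm) AE_iff_measurable[OF _ refl])
         (simp_all add: greaterThanLessThan_def greaterThan_def lessThan_def Int_def)
    with \<open>l < r\<close> show False by simp
  qed
  with that show thesis by auto
qed

text \<open>The sets over which \<open>h\<close> integrates to zero contain the intervals and are closed under
  complements and countable disjoint unions, hence contain all Borel sets.\<close>

lemma AE_zero_if_interval_integrals_zero:
  fixes h :: "real \<Rightarrow> 'a::euclidean_space"
  assumes int: "integrable lborel h" and supp: "\<And>x. x \<notin> {l..r} \<Longrightarrow> h x = 0"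
    and zero: "\<And>a b. (LINT x:{a..b}|lborel. h x) = 0"
  shows "AE x in lborel. h x = 0"
proof (rule sigma_finite_measure.density_zero[OF lborel.sigma_finite_measure_axioms int])
  have int_on: "set_integrable lborel A h" if "A \<in> sets borel" for A
    unfolding set_integrable_def using that int by (intro integrable_mult_indicator) auto
  have total: "(LINT x|lborel. h x) = 0"
  proof -
    have "(LINT x|lborel. h x) = (LINT x:{l..r}|lborel. h x)"
      unfolding set_lebesgue_integral_def using supp
      by (intro Bochner_Integration.integral_cong) (auto split: split_indicator)
    with zero show ?thesis by simp
  qed
  fix A :: "real set" assume "A \<in> sets lborel"
  then have "A \<in> sets borel" by simp
  then show "(LINT x:A|lborel. h x) = 0"
  proof (induction rule: borel_set_induct)
    case (compl A)
    have "(LINT x|lborel. h x) = (LINT x:A \<union> - A|lborel. h x)"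
      by (simp add: set_lebesgue_integral_def)
    also have "\<dots> = (LINT x:A|lborel. h x) + (LINT x:- A|lborel. h x)"
      using compl by (intro set_integral_Un int_on) auto
    finally show ?case using total compl by simp
  next
    case (union f)
    then have "(LINT x:(\<Union>i. f i)|lborel. h x) = (\<Sum>i. LINT x:f i|lborel. h x)"
      by (intro lebesgue_integral_countable_add int_on) (auto simp: disjoint_family_on_def)
    with union show ?case by simp
  qed (use zero in \<open>simp_all add: set_lebesgue_integral_def\<close>)
qed

lemma locally_integrable_diff:
  "locally_integrable f \<Longrightarrow> locally_integrable g \<Longrightarrow> locally_integrable (\<lambda>x. f x - g x)"
  by (auto simp: locally_integrable_def intro: set_integral_diff)

lemma locally_integrable_continuous:
  "continuous_on UNIV f \<Longrightarrow> locally_integrable f"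
  unfolding locally_integrable_def set_integrable_def
  using borel_integrable_compact continuous_on_subset by blast

lemma integrable_scaleR_locally_integrable:
  fixes f :: "real \<Rightarrow> 'a::euclidean_space"
  assumes f: "locally_integrable f" and cont: "continuous_on UNIV \<psi>"
    and supp: "\<And>x. x \<notin> {l..r} \<Longrightarrow> \<psi> x = 0"
  shows "integrable lborel (\<lambda>x. \<psi> x *\<^sub>R f x)"
proof -
  have "bounded (\<psi> ` {l..r})"
    by (intro compact_imp_bounded compact_continuous_image continuous_on_subset[OF cont]) auto
  then obtain B where B: "\<And>x. x \<in> {l..r} \<Longrightarrow> \<bar>\<psi> x\<bar> \<le> B"
    unfolding bounded_iff by (metis image_eqI real_norm_def)
  have int: "integrable lborel (\<lambda>x. indicator {l..r} x *\<^sub>R f x)"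
    using f by (simp add: locally_integrable_def set_integrable_def)
  have [measurable]: "\<psi> \<in> borel_measurable borel"
    using cont by (rule borel_measurable_continuous_onI)
  have "integrable lborel (\<lambda>x. \<psi> x *\<^sub>R (indicator {l..r} x *\<^sub>R f x))"
  proof (rule Bochner_Integration.integrable_bound)
    show "integrable lborel (\<lambda>x. B *\<^sub>R (indicator {l..r} x *\<^sub>R f x))"
      by (rule integrable_scaleR_right[OF int])
    show "(\<lambda>x. \<psi> x *\<^sub>R indicat_real {l..r} x *\<^sub>R f x) \<in> borel_measurable lborel"
      by (intro borel_measurable_scaleR[OF _ borel_measurable_integrable[OF int]]) simp
    show "AE x in lborel. norm (\<psi> x *\<^sub>R indicat_real {l..r} x *\<^sub>R f x)
        \<le> norm (B *\<^sub>R indicat_real {l..r} x *\<^sub>R f x)"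
      using B by (intro AE_I2) (auto split: split_indicator intro!: mult_right_mono order.trans[OF B abs_ge_self])
  qed
  also have "(\<lambda>x. \<psi> x *\<^sub>R (indicator {l..r} x *\<^sub>R f x)) = (\<lambda>x. \<psi> x *\<^sub>R f x)"
    using supp by (auto simp: fun_eq_iff split: split_indicator)
  finally show ?thesis .
qed

lemma test_function_has_derivative:
  "test_function \<psi> \<Longrightarrow> (\<psi> has_real_derivative deriv \<psi> x) (at x)"
  unfolding test_function_def
  by (metis DERIV_deriv_iff_real_differentiable UNIV_I differentiable_on_def funpow_0)

lemma test_function_continuous: "test_function \<psi> \<Longrightarrow> continuous_on UNIV \<psi>"
  by (meson DERIV_isCont continuous_at_imp_continuous_on test_function_has_derivative)

lemma test_function_deriv_continuous:
  assumes "test_function \<psi>" shows "continuous_on UNIV (deriv \<psi>)"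
proof -
  have "(deriv ^^ 1) \<psi> differentiable_on UNIV" using assms unfolding test_function_def by blast
  then show ?thesis by (auto intro: differentiable_imp_continuous_on)
qed

lemma test_function_support:
  assumes "test_function \<psi>"
  obtains R where "0 < R" "\<And>x. x \<notin> {-R<..<R} \<Longrightarrow> \<psi> x = 0" "\<And>x. x \<notin> {-R<..<R} \<Longrightarrow> deriv \<psi> x = 0"
proof -
  define K where "K = closure {x. \<psi> x \<noteq> 0}"
  have "bounded K" using assms compact_imp_bounded unfolding test_function_def K_def by blast
  then obtain R where R: "0 < R" "\<And>x. x \<in> K \<Longrightarrow> \<bar>x\<bar> < R"
    unfolding bounded_pos_less by auto
  have 1: "\<psi> x = 0" if "x \<notin> K" for x
    using that closure_subset[of "{x. \<psi> x \<noteq> 0}"] unfolding K_def by auto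
  have "open (- K)" by (simp add: K_def open_Compl)
  have 2: "deriv \<psi> x = 0" if "x \<notin> K" for x
  proof (rule DERIV_imp_deriv)
    have "((\<lambda>_. 0) has_real_derivative 0) (at x)" by simp
    then show "(\<psi> has_real_derivative 0) (at x)"
      by (rule has_field_derivative_transform_within_open[OF _ \<open>open (- K)\<close>]) (use that 1 in auto)
  qed
  have "x \<notin> K" if "x \<notin> {-R<..<R}" for x using R(2)[of x] that by auto
  then show thesis using that[of R] R(1) 1 2 by blast
qed

lemma integrable_test_scaleR:
  assumes "test_function \<psi>" "locally_integrable f"
  shows "integrable lborel (\<lambda>x. \<psi> x *\<^sub>R f x)" "integrable lborel (\<lambda>x. deriv \<psi> x *\<^sub>R f x)"
proof -
  obtain R where "0 < R" and R: "\<And>x. x \<notin> {-R<..<R} \<Longrightarrow> \<psi> x = 0" "\<And>x. x \<notin> {-R<..<R} \<Longrightarrow> deriv \<psi> x = 0"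
    using test_function_support[OF assms(1)] by blast
  show "integrable lborel (\<lambda>x. \<psi> x *\<^sub>R f x)" 
    by (rule integrable_scaleR_locally_integrable[OF assms(2) test_function_continuous[OF assms(1)], of "-R" R])
       (auto intro!: R)
  show "integrable lborel (\<lambda>x. deriv \<psi> x *\<^sub>R f x)"
    by (rule integrable_scaleR_locally_integrable[OF assms(2) test_function_deriv_continuous[OF assms(1)], of "-R" R])
       (auto intro!: R)
qed

text \<open>Testing against bumps and passing to the limit by dominated convergence shows that
  \<open>g\<close> integrates to zero over every interval.\<close>

lemma fundamental_lemma_calculus_of_variations:
  fixes g :: "real \<Rightarrow> 'a::euclidean_space"
  assumes g: "locally_integrable g"
    and zero: "\<And>\<psi>. test_function \<psi> \<Longrightarrow> (LINT x|lborel. \<psi> x *\<^sub>R g x) = 0"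
  shows "AE x in lborel. g x = 0"
proof -
  have int: "integrable lborel (\<lambda>x. indicator {l..r} x *\<^sub>R g x)" for l r
    using g by (simp add: locally_integrable_def set_integrable_def)
  have interval: "(LINT x:{l..r}|lborel. g x) = 0" for l r
  proof -
    have "(\<lambda>n. LINT x|lborel. bump l r n x *\<^sub>R g x)
        \<longlonglongrightarrow> (LINT x|lborel. indicator {l<..<r} x *\<^sub>R (indicator {l..r} x *\<^sub>R g x))"
    proof (rule integral_dominated_convergence[where w = "\<lambda>x. norm (indicator {l..r} x *\<^sub>R g x)"])
      show "(\<lambda>x. indicat_real {l<..<r} x *\<^sub>R indicat_real {l..r} x *\<^sub>R g x) \<in> borel_measurable lborel"
        by (rule borel_measurable_scaleR[OF _ borel_measurable_integrable[OF int]]) simp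
      show "integrable lborel (\<lambda>x. norm (indicat_real {l..r} x *\<^sub>R g x))"
        by (rule integrable_norm[OF int])
      show "(\<lambda>x. bump l r n x *\<^sub>R g x) \<in> borel_measurable lborel" for n
        by (rule borel_measurable_integrable[OF integrable_test_scaleR(1)[OF test_function_bump g]])
      show "AE x in lborel. (\<lambda>n. bump l r n x *\<^sub>R g x)
          \<longlonglongrightarrow> indicat_real {l<..<r} x *\<^sub>R indicat_real {l..r} x *\<^sub>R g x"
      proof (rule AE_I2)
        fix x
        have eq: "indicat_real {l<..<r} x *\<^sub>R indicat_real {l..r} x *\<^sub>R g x = indicat_real {l<..<r} x *\<^sub>R g x"
          by (simp split: split_indicator)
        show "(\<lambda>n. bump l r n x *\<^sub>R g x) \<longlonglongrightarrow> indicat_real {l<..<r} x *\<^sub>R indicat_real {l..r} x *\<^sub>R g x"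
          unfolding eq by (intro tendsto_scaleR bump_tendsto_indicator tendsto_const)
      qed
      show "AE x in lborel. norm (bump l r n x *\<^sub>R g x) \<le> norm (indicat_real {l..r} x *\<^sub>R g x)" for n
        using bump_bounds[of l r n] bump_outside[of _ l r n]
        by (intro AE_I2) (auto split: split_indicator intro!: mult_left_le_one_le)
    qed
    then have "(LINT x|lborel. indicator {l<..<r} x *\<^sub>R (indicator {l..r} x *\<^sub>R g x)) = 0"
      using zero[OF test_function_bump] by (simp add: LIMSEQ_const_iff)
    moreover have "(LINT x|lborel. indicator {l<..<r} x *\<^sub>R (indicator {l..r} x *\<^sub>R g x))
        = (LINT x|lborel. indicator {l..r} x *\<^sub>R g x)"
    proof (rule integral_cong_AE)
      show "(\<lambda>x. indicat_real {l<..<r} x *\<^sub>R indicat_real {l..r} x *\<^sub>R g x) \<in> borel_measurable lborel"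
        by (rule borel_measurable_scaleR[OF _ borel_measurable_integrable[OF int]]) simp
      show "AE x in lborel. indicat_real {l<..<r} x *\<^sub>R indicat_real {l..r} x *\<^sub>R g x = indicat_real {l..r} x *\<^sub>R g x"
        using AE_lborel_singleton[of l] AE_lborel_singleton[of r]
        by eventually_elim (auto split: split_indicator)
    qed (rule borel_measurable_integrable[OF int])
    ultimately show ?thesis by (simp add: set_lebesgue_integral_def)
  qed
  have "AE x in lborel. indicator {- real n..real n} x *\<^sub>R g x = 0" for n
  proof (rule AE_zero_if_interval_integrals_zero[OF int, where l="- real n" and r="real n"])
    show "(LINT x:{a..b}|lborel. indicat_real {- real n..real n} x *\<^sub>R g x) = 0" for a b
      using interval[of "max a (- real n)" "min b (real n)"]
      by (simp add: set_lebesgue_integral_def flip: indicator_inter_arith)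
  qed auto
  then have "AE x in lborel. \<forall>n. indicator {- real n..real n} x *\<^sub>R g x = 0"
    unfolding AE_all_countable by blast
  then show ?thesis
  proof eventually_elim
    case (elim x)
    obtain n where "\<bar>x\<bar> \<le> real n" using real_arch_simple by blast
    with elim[rule_format, of n] show ?case by (auto simp: abs_le_iff split: split_indicator_asm)
  qed
qed

lemma weak_deriv_unique_AE:
  fixes f g f' g' :: "real \<Rightarrow> 'a::euclidean_space"
  assumes fg: "has_weak_deriv f g" and fg': "has_weak_deriv f' g'" and eq: "AE x in lborel. f x = f' x"
  shows "AE x in lborel. g x = g' x"
proof -
  have loc: "locally_integrable f" "locally_integrable f'" "locally_integrable g" "locally_integrable g'"
    using fg fg' by (auto simp: has_weak_deriv_def)
  have "AE x in lborel. g x - g' x = 0"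
  proof (rule fundamental_lemma_calculus_of_variations[OF locally_integrable_diff[OF loc(3,4)]])
    fix \<psi> assume \<psi>: "test_function \<psi>"
    note int = integrable_test_scaleR[OF \<psi>]
    have "(LINT x|lborel. \<psi> x *\<^sub>R (g x - g' x)) = (LINT x|lborel. \<psi> x *\<^sub>R g x) - (LINT x|lborel. \<psi> x *\<^sub>R g' x)"
      using int(1)[OF loc(3)] int(1)[OF loc(4)] by (simp add: scaleR_diff_right)
    also have "\<dots> = (LINT x|lborel. deriv \<psi> x *\<^sub>R f' x) - (LINT x|lborel. deriv \<psi> x *\<^sub>R f x)"
      using fg fg' \<psi> by (simp add: has_weak_deriv_def)
    also have "(LINT x|lborel. deriv \<psi> x *\<^sub>R f' x) = (LINT x|lborel. deriv \<psi> x *\<^sub>R f x)"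
      using borel_measurable_integrable[OF int(2)[OF loc(1)]] borel_measurable_integrable[OF int(2)[OF loc(2)]] eq
      by (intro integral_cong_AE) auto
    finally show "(LINT x|lborel. \<psi> x *\<^sub>R (g x - g' x)) = 0" by simp
  qed
  then show ?thesis by simp
qed


section \<open>Primitives and the du Bois-Reymond lemma\<close>

lemma set_integrable_locally_integrable:
  assumes "locally_integrable g" "A \<in> sets borel" "bounded A"
  shows "set_integrable lborel A g"
proof -
  have "compact (closure A)" using assms(3) by simp
  then have "set_integrable lborel (closure A) g" using assms(1) by (simp add: locally_integrable_def)
  then show ?thesis
    by (rule set_integrable_subset) (use assms(2) closure_subset[of A] in auto)
qed

text \<open>Half-open intervals make the pieces disjoint, so additivity holds exactly; one of the
  two terms always vanishes, and their difference is the oriented integral from \<open>0\<close> to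
  \<open>x\<close>.\<close>

definition primitive :: "(real \<Rightarrow> real) \<Rightarrow> real \<Rightarrow> real" where
  "primitive g x = (LINT y:{0<..x}|lborel. g y) - (LINT y:{x<..0}|lborel. g y)"

lemma primitive_diff:
  assumes g: "locally_integrable g" and "x \<le> y"
  shows "primitive g y - primitive g x = (LINT z:{x<..y}|lborel. g z)"
proof -
  have join: "(LINT z:{a<..c}|lborel. g z) = (LINT z:{a<..b}|lborel. g z) + (LINT z:{b<..c}|lborel. g z)"
    if "a \<le> b" "b \<le> c" for a b c
  proof -
    have "{a<..c} = {a<..b} \<union> {b<..c}" using that by auto
    then show ?thesis
      by (simp only:) (intro set_integral_Un set_integrable_locally_integrable[OF g]; auto)
  qed
  have empty: "(LINT z:{a<..b}|lborel. g z) = 0" if "b \<le> a" for a b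
    using that by (simp add: set_lebesgue_integral_def)
  have empty': "(LINT z:{}|lborel. g z) = 0"
    by (simp add: set_lebesgue_integral_def)
  consider "0 \<le> x" | "x \<le> 0" "0 \<le> y" | "y \<le> 0" by linarith
  then show ?thesis
  proof cases
    case 1 with join[of 0 x y] \<open>x \<le> y\<close> show ?thesis by (simp add: primitive_def empty empty')
  next
    case 2 with join[of x 0 y] show ?thesis by (simp add: primitive_def empty empty')
  next
    case 3 with join[of x y 0] \<open>x \<le> y\<close> show ?thesis by (simp add: primitive_def empty empty')
  qed
qed

lemma primitive_eq_integral:
  assumes g: "locally_integrable g" and "a \<le> t"
  shows "primitive g t = primitive g a + integral {a..t} g"
proof -
  have "(LINT z:{a<..t}|lborel. g z) = integral {a<..t} g"
    by (rule set_borel_integral_eq_integral(2)[OF set_integrable_locally_integrable[OF g]]) auto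
  also have "\<dots> = integral {a..t} g"
    by (rule integral_subset_negligible) (auto intro: negligible_subset[of "{a}"])
  finally show ?thesis using primitive_diff[OF g \<open>a \<le> t\<close>] by auto
qed

lemma continuous_primitive:
  assumes g: "locally_integrable g"
  shows "continuous_on UNIV (primitive g)"
proof -
  have "isCont (primitive g) x" for x
  proof -
    define a where "a = x - 1"
    have "g integrable_on {a..x+1}"
      by (rule set_borel_integral_eq_integral(1)[OF set_integrable_locally_integrable[OF g]]) auto
    then have "continuous_on {a..x+1} (\<lambda>t. primitive g a + integral {a..t} g)"
      by (intro continuous_on_add continuous_on_const indefinite_integral_continuous_1)
    then have "continuous_on {a..x+1} (primitive g)"
      by (rule continuous_on_eq) (rule primitive_eq_integral[OF g, symmetric], simp)
    then show ?thesis by (rule continuous_on_interior) (auto simp: a_def)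
  qed
  then show ?thesis by (simp add: continuous_at_imp_continuous_on)
qed

lemma primitive_has_derivative:
  assumes v: "continuous_on UNIV v"
  shows "(primitive v has_real_derivative v x) (at x)"
proof -
  define a where "a = x - 1"
  have "((\<lambda>t. integral {a..t} v) has_real_derivative v x) (at x within {a..x + 1})"
    by (rule integral_has_real_derivative[OF continuous_on_subset[OF v]]) (auto simp: a_def)
  then have "((\<lambda>t. integral {a..t} v) has_real_derivative v x) (at x)"
    by (subst (asm) at_within_interior) (auto simp: a_def)
  then have "((\<lambda>t. primitive v a + integral {a..t} v) has_real_derivative v x) (at x)"
    by (auto intro!: derivative_eq_intros)
  then show ?thesis
    by (rule has_field_derivative_transform_within_open[where S="{a<..}"])
       (use primitive_eq_integral[OF locally_integrable_continuous[OF v], of a, symmetric]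
        in \<open>auto simp: a_def\<close>)
qed

text \<open>Up to a constant the integral over the left half-line is a primitive. It is used for
  the gauge phase and as a bounded monotone function in comparison arguments.\<close>

lemma left_tail_integral_has_derivative:
  fixes v :: "real \<Rightarrow> real"
  assumes cont: "continuous_on UNIV v" and int: "integrable lborel v"
  shows "((\<lambda>x. LINT y:{..x}|lborel. v y) has_real_derivative v x) (at x)"
proof -
  have int_on: "set_integrable lborel A v" if "A \<in> sets borel" for A
    unfolding set_integrable_def using that int by (intro integrable_mult_indicator) auto
  have "(LINT y:{..t}|lborel. v y) = (LINT y:{..0}|lborel. v y) + primitive v t" for t
  proof -
    have split: "(LINT y:{..t}|lborel. v y) = (LINT y:{..s}|lborel. v y) + (LINT y:{s<..t}|lborel. v y)"
      if "s \<le> t" for s t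
    proof -
      have "{..t} = {..s} \<union> {s<..t}" using that by auto
      then show ?thesis by (simp only:) (intro set_integral_Un int_on; auto)
    qed
    show ?thesis
      using split[of 0 t] split[of t 0]
      by (cases "0 \<le> t") (simp_all add: primitive_def set_lebesgue_integral_def)
  qed
  then have eq: "(\<lambda>t. LINT y:{..t}|lborel. v y) = (\<lambda>t. (LINT y:{..0}|lborel. v y) + primitive v t)"
    by (rule ext)
  have "((\<lambda>t. (LINT y:{..0}|lborel. v y) + primitive v t) has_real_derivative v x) (at x)"
    by (auto intro!: derivative_eq_intros primitive_has_derivative[OF cont])
  then show ?thesis by (simp only: eq)
qed

text \<open>Integration by parts for a factor that is only locally integrable: writing the
  primitive as an integral and exchanging the order of integration with Fubini replaces
  \<open>deriv \<psi>\<close> by the integral of \<open>deriv \<psi>\<close> over $[y, \infty)$, which is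
  $-\psi(y)$.\<close>

lemma primitive_has_weak_deriv:
  assumes g: "locally_integrable g"
  shows "has_weak_deriv (primitive g) g"
  unfolding has_weak_deriv_def
proof (intro conjI allI impI g locally_integrable_continuous continuous_primitive)
  fix \<psi> assume \<psi>: "test_function \<psi>"
  obtain R where "0 < R" and R: "\<And>x. x \<notin> {-R<..<R} \<Longrightarrow> \<psi> x = 0" "\<And>x. x \<notin> {-R<..<R} \<Longrightarrow> deriv \<psi> x = 0"
    using test_function_support[OF \<psi>] by blast
  let ?d = "deriv \<psi>"
  have int_d: "integrable lborel ?d"
    using integrable_test_scaleR(2)[OF \<psi>, of "\<lambda>_. 1::real"] 
    by (simp add: locally_integrable_continuous)
  define h where "h y = indicator {-R<..R} y * g y" for y
  have int_h: "integrable lborel h"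
    using set_integrable_locally_integrable[OF g, of "{-R<..R}"]
    by (simp add: h_def[abs_def] set_integrable_def)
  note [measurable] = borel_measurable_integrable[OF int_d] borel_measurable_integrable[OF int_h]
  have int_d_above: "(LINT x|lborel. indicator {y..} x * ?d x) = - \<psi> y" for y
  proof (cases "y \<le> R")
    case True
    have "(LINT x|lborel. indicator {y..} x * ?d x) = (LINT x|lborel. ?d x * indicator {y..R} x)"
      by (rule Bochner_Integration.integral_cong) (auto simp: R split: split_indicator)
    also have "\<dots> = \<psi> R - \<psi> y"
      using True test_function_has_derivative[OF \<psi>] test_function_deriv_continuous[OF \<psi>]
      by (intro integral_FTC_Icc_real) (auto simp: continuous_on_eq_continuous_at)
    finally show ?thesis by (simp add: R)
  next
    case False
    then have "(LINT x|lborel. indicator {y..} x * ?d x) = (LINT x::real|lborel. 0)"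
      by (intro Bochner_Integration.integral_cong) (auto simp: R split: split_indicator)
    with False show ?thesis by (simp add: R)
  qed
  have total: "(LINT x|lborel. ?d x) = 0"
  proof -
    have "(LINT x|lborel. ?d x) = (LINT x|lborel. indicator {-R..} x * ?d x)"
      by (rule Bochner_Integration.integral_cong) (auto simp: R split: split_indicator)
    then show ?thesis by (simp add: int_d_above R)
  qed
  \<comment> \<open>the integrand of the double integral: \<open>h\<close> below the diagonal, times \<open>deriv \<psi>\<close>\<close>
  define H where "H x y = ?d x * (indicator {..x} y * h y)" for x y
  have int_H: "integrable (lborel \<Otimes>\<^sub>M lborel) (case_prod H)"
  proof (rule Bochner_Integration.integrable_bound)
    show "integrable (lborel \<Otimes>\<^sub>M lborel) (\<lambda>(x, y). ?d x * h y)"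
    proof (rule lborel_pair.Fubini_integrable)
      show "(\<lambda>(x, y). ?d x * h y) \<in> borel_measurable (lborel \<Otimes>\<^sub>M lborel)" by measurable
      show "integrable lborel (\<lambda>x. LBINT y. norm (case (x, y) of (x, y) \<Rightarrow> ?d x * h y))"
        using int_d int_h by (simp add: abs_mult)
      show "AE x in lborel. integrable lborel (\<lambda>y. case (x, y) of (x, y) \<Rightarrow> ?d x * h y)"
        using int_h by simp
    qed
    have "(\<lambda>p. H (fst p) (snd p)) = (\<lambda>p. ?d (fst p) * ((if snd p \<le> fst p then 1 else 0) * h (snd p)))"
      by (auto simp: H_def fun_eq_iff split: split_indicator)
    moreover have "\<dots> \<in> borel_measurable (lborel \<Otimes>\<^sub>M lborel)" by measurable
    ultimately show "case_prod H \<in> borel_measurable (lborel \<Otimes>\<^sub>M lborel)"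
      by (simp add: case_prod_beta')
    show "AE p in lborel \<Otimes>\<^sub>M lborel. norm (case_prod H p) \<le> norm (case p of (x, y) \<Rightarrow> ?d x * h y)"
      by (intro AE_I2) (auto simp: H_def split: split_indicator)
  qed
  have inner_x: "(LINT y|lborel. H x y) = ?d x * (primitive g x - primitive g (- R))" for x
  proof (cases "x \<in> {-R<..<R}")
    case True
    have "(LINT y|lborel. H x y) = ?d x * (LINT y|lborel. indicator {..x} y * h y)"
      by (simp add: H_def)
    also have "(LINT y|lborel. indicator {..x} y * h y) = (LINT z:{-R<..x}|lborel. g z)"
      unfolding set_lebesgue_integral_def using True
      by (intro Bochner_Integration.integral_cong) (auto simp: h_def split: split_indicator)
    finally show ?thesis using primitive_diff[OF g, of "-R" x] True by simp
  qed (simp add: H_def R)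
  have inner_y: "(LINT x|lborel. H x y) = - (\<psi> y * g y)" for y
  proof -
    have "(LINT x|lborel. H x y) = (LINT x|lborel. (indicator {y..} x * ?d x) * h y)"
      by (rule Bochner_Integration.integral_cong) (auto simp: H_def split: split_indicator)
    also have "\<dots> = - \<psi> y * h y" by (simp add: int_d_above)
    also have "\<dots> = - (\<psi> y * g y)"
      by (cases "y \<in> {-R<..<R}") (auto simp: h_def R)
    finally show ?thesis .
  qed
  have int_dF: "integrable lborel (\<lambda>x. ?d x * primitive g x)"
    using integrable_test_scaleR(2)[OF \<psi> locally_integrable_continuous[OF continuous_primitive[OF g]]] by simp
  have "(LINT x|lborel. ?d x * primitive g x) = (LINT x|lborel. ?d x * (primitive g x - primitive g (- R)))"
    using int_dF int_d total by (simp add: right_diff_distrib)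
  also have "\<dots> = (LINT y|lborel. LINT x|lborel. H x y)"
    using lborel_pair.Fubini_integral[OF int_H] by (simp add: inner_x)
  also have "\<dots> = - (LINT y|lborel. \<psi> y * g y)" by (simp add: inner_y)
  finally show "(LINT x|lborel. ?d x *\<^sub>R primitive g x) = - (LINT x|lborel. \<psi> x *\<^sub>R g x)" by simp
qed

lemma times_differentiable_test: "test_function \<psi> \<Longrightarrow> times_differentiable n \<psi>"
  by (simp add: test_function_def all_derivs_differentiable_iff)

text \<open>The du Bois-Reymond lemma. If \<open>\<rho>\<close> is a bump of nonzero mass \<open>I\<close>, then for any test
  function \<open>\<eta>\<close> the function $\eta - (\int\eta / I)\,\rho$ has mean zero, so its integral from
  $-\infty$ is again a test function, now with that derivative. Testing with it shows that
  \<open>h\<close> minus a constant is orthogonal to \<open>\<eta>\<close>.\<close>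

lemma weak_deriv_zero_AE_const:
  fixes h :: "real \<Rightarrow> real"
  assumes h: "has_weak_deriv h (\<lambda>_. 0)"
  obtains c where "AE x in lborel. h x = c"
proof -
  have loc: "locally_integrable h" using h by (simp add: has_weak_deriv_def)
  define \<rho> where "\<rho> = bump 0 1 1"
  have \<rho>: "test_function \<rho>" "\<And>x. 0 \<le> \<rho> x" "\<And>x. x \<notin> {0..1} \<Longrightarrow> \<rho> x = 0"
    unfolding \<rho>_def by (auto intro: test_function_bump bump_bounds bump_outside)
  have int_test: "integrable lborel \<eta>" if "test_function \<eta>" for \<eta>
    using integrable_test_scaleR(1)[OF that, of "\<lambda>_. 1::real"] by (simp add: locally_integrable_continuous)
  have "(LINT x|lborel. \<rho> x) \<noteq> 0"
  proof
    assume "(LINT x|lborel. \<rho> x) = 0"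
    then have "AE x in lborel. \<rho> x = 0"
      using integral_nonneg_eq_0_iff_AE[OF int_test[OF \<rho>(1)]] \<rho>(2) by auto
    then obtain x where "0 < x" "x < 1" "\<rho> x = 0"
      using AE_imp_ex_in_interval[of "\<lambda>x. \<rho> x = 0" 0 1] zero_less_one by blast
    then show False by (auto simp: \<rho>_def bump_def flat_exp_def)
  qed
  define I where "I = (LINT x|lborel. \<rho> x)"
  have "I \<noteq> 0" unfolding I_def by fact
  define c where "c = (LINT x|lborel. \<rho> x * h x) / I"
  have int_h: "integrable lborel (\<lambda>x. \<eta> x * h x)" if "test_function \<eta>" for \<eta>
    using integrable_test_scaleR(1)[OF that loc] by simp
  have "AE x in lborel. h x - c = 0"
  proof (rule fundamental_lemma_calculus_of_variations[OF locally_integrable_diff[OF loc locally_integrable_continuous]])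
    fix \<eta> assume \<eta>: "test_function \<eta>"
    obtain R where "0 < R" and R: "\<And>x. x \<notin> {-R<..<R} \<Longrightarrow> \<eta> x = 0"
        "\<And>x. x \<notin> {-R<..<R} \<Longrightarrow> deriv \<eta> x = 0"
      using test_function_support[OF \<eta>] by blast
    define J where "J = (LINT x|lborel. \<eta> x)"
    \<comment> \<open>the multiple of the bump makes \<open>k\<close> integrate to zero\<close>
    define k where "k x = \<eta> x + - (J / I) * \<rho> x" for x
    have k_smooth: "times_differentiable n k" for n
      unfolding k_def[abs_def]
      by (intro times_differentiable_add times_differentiable_mult times_differentiable_const
          times_differentiable_test \<eta> \<rho>(1))
    have k_int: "integrable lborel k"
      unfolding k_def[abs_def] using int_test[OF \<eta>] int_test[OF \<rho>(1)] by simp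
    have k_total: "(LINT x|lborel. k x) = 0"
      unfolding k_def[abs_def] using int_test[OF \<eta>] int_test[OF \<rho>(1)] \<open>I \<noteq> 0\<close>
      by (simp add: flip: I_def J_def)
    have k_supp: "k x = 0" if "x \<notin> {- R..R + 1}" for x
      using that R(1)[of x] \<rho>(3)[of x] \<open>0 < R\<close> by (auto simp: k_def)
    have k_cont: "continuous_on UNIV k"
      unfolding k_def[abs_def]
      by (intro continuous_intros test_function_continuous \<eta> \<rho>(1))
    define \<psi> where "\<psi> x = (LINT y:{..x}|lborel. k y)" for x
    have der: "(\<psi> has_real_derivative k x) (at x)" for x
      unfolding \<psi>_def[abs_def] by (rule left_tail_integral_has_derivative[OF k_cont k_int])
    have deriv_eq: "deriv \<psi> = k" using der DERIV_imp_deriv by blast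
    have "test_function \<psi>"
    proof (rule test_functionI)
      show "times_differentiable n \<psi>" for n
        using der k_smooth times_differentiable_Suc_iff times_differentiable_SucD by blast
      show "\<psi> x = 0" if outside: "x \<notin> {- R..R + 1}" for x
      proof -
        consider "x < - R" | "R + 1 < x" using outside by force
        then show ?thesis
        proof cases
          case 1
          then have "\<psi> x = (LINT y::real|lborel. 0)"
            unfolding \<psi>_def set_lebesgue_integral_def
            by (intro Bochner_Integration.integral_cong) (auto simp: k_supp split: split_indicator)
          then show ?thesis by simp
        next
          case 2
          then have "\<psi> x = (LINT y|lborel. k y)"
            unfolding \<psi>_def set_lebesgue_integral_def
            by (intro Bochner_Integration.integral_cong) (auto simp: k_supp split: split_indicator)
          with k_total show ?thesis by simp
        qed
      qed
    qed
    with h have "(LINT x|lborel. deriv \<psi> x *\<^sub>R h x) = 0"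
      unfolding has_weak_deriv_def by simp
    then have "(LINT x|lborel. k x * h x) = 0" by (simp add: deriv_eq)
    moreover have "(LINT x|lborel. k x * h x) = (LINT x|lborel. \<eta> x * h x) - J * c"
      unfolding k_def[abs_def] c_def
      using int_h[OF \<eta>] int_h[OF \<rho>(1)] by (simp add: distrib_right left_diff_distrib mult.assoc)
    moreover have "(LINT x|lborel. \<eta> x * (h x - c)) = (LINT x|lborel. \<eta> x * h x) - J * c"
      using int_h[OF \<eta>] int_test[OF \<eta>] by (simp add: right_diff_distrib J_def)
    ultimately show "(LINT x|lborel. \<eta> x *\<^sub>R (h x - c)) = 0" by simp
  qed simp
  then show thesis by (intro that[of c]) simp
qed

text \<open>Subtracting a primitive reduces this to a vanishing weak derivative.\<close>

lemma weak_deriv_AE_primitive: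
  fixes f g :: "real \<Rightarrow> real"
  assumes fg: "has_weak_deriv f g"
  obtains c where "AE x in lborel. f x = c + primitive g x"
proof -
  have loc: "locally_integrable f" "locally_integrable g" using fg by (auto simp: has_weak_deriv_def)
  note F = primitive_has_weak_deriv[OF loc(2)]
  then have locF: "locally_integrable (primitive g)" by (auto simp: has_weak_deriv_def)
  have "has_weak_deriv (\<lambda>x. f x - primitive g x) (\<lambda>_. 0)"
    unfolding has_weak_deriv_def
  proof (intro conjI allI impI)
    fix \<psi> assume \<psi>: "test_function \<psi>"
    have "(LINT x|lborel. deriv \<psi> x *\<^sub>R (f x - primitive g x))
        = (LINT x|lborel. deriv \<psi> x *\<^sub>R f x) - (LINT x|lborel. deriv \<psi> x *\<^sub>R primitive g x)"
      unfolding scaleR_diff_right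
      by (intro Bochner_Integration.integral_diff integrable_test_scaleR \<psi> loc locF)
    then show "(LINT x|lborel. deriv \<psi> x *\<^sub>R (f x - primitive g x)) = - (LINT x|lborel. \<psi> x *\<^sub>R 0)"
      using fg F \<psi> by (simp add: has_weak_deriv_def)
  qed (use loc locF in \<open>auto intro: locally_integrable_diff locally_integrable_continuous\<close>)
  then obtain c where "AE x in lborel. f x - primitive g x = c" by (rule weak_deriv_zero_AE_const)
  then show thesis by (intro that[of c]) (auto elim!: eventually_mono)
qed


section \<open>Weak solutions are classical\<close>

lemma locally_integrable_cong_AE:
  fixes f u :: "real \<Rightarrow> 'a::euclidean_space"
  assumes "locally_integrable u" "f \<in> borel_measurable borel" "AE x in lborel. f x = u x"
  shows "locally_integrable f"
  unfolding locally_integrable_def set_integrable_def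
proof (intro allI impI)
  fix K :: "real set" assume "compact K"
  then have "integrable lborel (\<lambda>x. indicator K x *\<^sub>R u x)"
    using assms(1) by (simp add: locally_integrable_def set_integrable_def)
  moreover have "K \<in> sets borel" using \<open>compact K\<close> by (simp add: borel_compact)
  then have "(\<lambda>x. indicator K x *\<^sub>R f x) \<in> borel_measurable lborel" using assms(2) by simp
  moreover have "AE x in lborel. indicator K x *\<^sub>R u x = indicator K x *\<^sub>R f x"
    using assms(3) by eventually_elim simp
  ultimately show "integrable lborel (\<lambda>x. indicator K x *\<^sub>R f x)"
    using integrable_cong_AE_imp by blast
qed

lemma has_weak_deriv_cong_AE:
  fixes f g g' :: "real \<Rightarrow> 'a::euclidean_space"
  assumes fg: "has_weak_deriv f g" and g': "locally_integrable g'" and eq: "AE x in lborel. g x = g' x"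
  shows "has_weak_deriv f g'"
  unfolding has_weak_deriv_def
proof (intro conjI allI impI g')
  show "locally_integrable f" using fg by (simp add: has_weak_deriv_def)
  have g: "locally_integrable g" using fg by (simp add: has_weak_deriv_def)
  fix \<psi> assume \<psi>: "test_function \<psi>"
  have "(LINT x|lborel. \<psi> x *\<^sub>R g x) = (LINT x|lborel. \<psi> x *\<^sub>R g' x)"
    using integrable_test_scaleR(1)[OF \<psi> g] integrable_test_scaleR(1)[OF \<psi> g'] eq
    by (intro integral_cong_AE) auto
  with fg \<psi> show "(LINT x|lborel. deriv \<psi> x *\<^sub>R f x) = - (LINT x|lborel. \<psi> x *\<^sub>R g' x)"
    by (simp add: has_weak_deriv_def)
qed

lemma has_weak_deriv_classical:
  fixes f u u' :: "real \<Rightarrow> 'a::euclidean_space"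
  assumes f: "f \<in> borel_measurable borel" and eq: "AE x in lborel. f x = u x"
    and der: "\<And>x. (u has_vector_derivative u' x) (at x)" and cont: "continuous_on UNIV u'"
  shows "has_weak_deriv f u'"
  unfolding has_weak_deriv_def
proof (intro conjI allI impI)
  have "continuous_on UNIV u"
    using der by (meson continuous_at_imp_continuous_on has_vector_derivative_continuous)
  then have u: "locally_integrable u" by (rule locally_integrable_continuous)
  then show loc_f: "locally_integrable f" using f eq by (rule locally_integrable_cong_AE)
  show u': "locally_integrable u'" using cont by (rule locally_integrable_continuous)
  fix \<psi> assume \<psi>: "test_function \<psi>"
  obtain R where "0 < R" and R: "\<And>x. x \<notin> {-R<..<R} \<Longrightarrow> \<psi> x = 0" "\<And>x. x \<notin> {-R<..<R} \<Longrightarrow> deriv \<psi> x = 0"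
    using test_function_support[OF \<psi>] by blast
  let ?p = "\<lambda>x. \<psi> x *\<^sub>R u' x + deriv \<psi> x *\<^sub>R u x"
  have der_prod: "((\<lambda>x. \<psi> x *\<^sub>R u x) has_vector_derivative ?p x) (at x within S)" for x S
    using has_vector_derivative_scaleR[of \<psi> "deriv \<psi> x" x S u "u' x"]
      DERIV_subset[OF test_function_has_derivative[OF \<psi>, of x], of S]
      has_vector_derivative_at_within[OF der[of x], of S] by auto
  have "continuous_on {-R..R} ?p"
    by (rule continuous_on_subset[of UNIV])
       (intro continuous_on_add continuous_on_scaleR test_function_continuous[OF \<psi>]
         test_function_deriv_continuous[OF \<psi>] cont \<open>continuous_on UNIV u\<close> subset_UNIV)+
  with der_prod have "(LINT x|lborel. indicator {-R..R} x *\<^sub>R ?p x) = \<psi> R *\<^sub>R u R - \<psi> (- R) *\<^sub>R u (- R)"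
    using \<open>0 < R\<close> by (intro integral_FTC_Icc) auto
  also have "\<dots> = 0" by (simp add: R)
  also have "(\<lambda>x. indicator {-R..R} x *\<^sub>R ?p x) = ?p"
    by (auto simp: fun_eq_iff R split: split_indicator)
  also have "(LINT x|lborel. ?p x) = (LINT x|lborel. \<psi> x *\<^sub>R u' x) + (LINT x|lborel. deriv \<psi> x *\<^sub>R u x)"
    by (intro Bochner_Integration.integral_add integrable_test_scaleR \<psi> u u')
  also have "(LINT x|lborel. deriv \<psi> x *\<^sub>R u x) = (LINT x|lborel. deriv \<psi> x *\<^sub>R f x)"
    using integrable_test_scaleR(2)[OF \<psi> u] integrable_test_scaleR(2)[OF \<psi> loc_f] eq
    by (intro integral_cong_AE) auto
  finally show "(LINT x|lborel. deriv \<psi> x *\<^sub>R f x) = - (LINT x|lborel. \<psi> x *\<^sub>R u' x)"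
    by (simp add: add_eq_0_iff)
qed

text \<open>The preimage of a closed set is closed, and a closed set of full measure is everything.\<close>

lemma closed_AE_imp_all:
  fixes u :: "real \<Rightarrow> 'a::topological_space"
  assumes "AE x in lborel. u x \<in> C" "continuous_on UNIV u" "closed C"
  shows "u x \<in> C"
proof -
  have "closed (u -` C)" using assms(2,3) by (simp add: closed_vimage continuous_on_closed_vimage)
  moreover have "AE x in lebesgue. x \<in> u -` C" using AE_completion[OF assms(1)] by simp
  ultimately have "x \<in> u -` C" by (rule mem_closed_if_AE_lebesgue)
  then show ?thesis by simp
qed

text \<open>The function and its weak derivative agree almost everywhere with primitives, hence
  with continuous functions. The equation then makes the second derivative continuous, and
  taking primitives once more gives two genuine derivatives.\<close>

lemma weak_second_order_solution_classical:
  fixes f f' f'' :: "real \<Rightarrow> real"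
  assumes w1: "has_weak_deriv f f'" and w2: "has_weak_deriv f' f''"
    and eq: "AE x in lborel. f'' x = N (f x)" and N: "continuous_on UNIV N"
  obtains u u' where "AE x in lborel. f x = u x" "AE x in lborel. f' x = u' x"
    "\<And>x. (u has_real_derivative u' x) (at x)" "\<And>x. (u' has_real_derivative N (u x)) (at x)"
proof -
  obtain c1 where c1: "AE x in lborel. f' x = c1 + primitive f'' x"
    using weak_deriv_AE_primitive[OF w2] by blast
  define v where "v x = c1 + primitive f'' x" for x
  have v: "continuous_on UNIV v" unfolding v_def[abs_def]
    using w2 by (intro continuous_on_add continuous_on_const continuous_primitive) (simp add: has_weak_deriv_def)
  have f'_v: "AE x in lborel. f' x = v x" using c1 by (simp add: v_def)
  have "has_weak_deriv f v"
    using has_weak_deriv_cong_AE[OF w1 locally_integrable_continuous[OF v] f'_v] .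
  then obtain c0 where c0: "AE x in lborel. f x = c0 + primitive v x"
    using weak_deriv_AE_primitive by blast
  define u where "u x = c0 + primitive v x" for x
  have f_u: "AE x in lborel. f x = u x" using c0 by (simp add: u_def)
  have u: "(u has_real_derivative v x) (at x)" for x
    unfolding u_def[abs_def] by (auto intro!: derivative_eq_intros primitive_has_derivative[OF v])
  have Nu: "continuous_on UNIV (\<lambda>x. N (u x))"
    by (rule continuous_on_compose2[OF N DERIV_continuous_on[OF u]]) auto
  have "AE x in lborel. f'' x = N (u x)" using eq f_u by eventually_elim simp
  from has_weak_deriv_cong_AE[OF w2 locally_integrable_continuous[OF Nu] this]
  obtain c2 where c2: "AE x in lborel. f' x = c2 + primitive (\<lambda>x. N (u x)) x"
    using weak_deriv_AE_primitive by blast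
  have "v x - (c2 + primitive (\<lambda>x. N (u x)) x) \<in> {0}" for x
  proof (rule closed_AE_imp_all[where u="\<lambda>x. v x - (c2 + primitive (\<lambda>x. N (u x)) x)"])
    show "AE x in lborel. v x - (c2 + primitive (\<lambda>x. N (u x)) x) \<in> {0}"
      using c2 f'_v by eventually_elim simp
    show "continuous_on UNIV (\<lambda>x. v x - (c2 + primitive (\<lambda>x. N (u x)) x))"
      by (intro continuous_intros v continuous_primitive locally_integrable_continuous[OF Nu])
  qed simp
  then have "v = (\<lambda>x. c2 + primitive (\<lambda>x. N (u x)) x)" by (simp add: fun_eq_iff)
  moreover have "((\<lambda>x. c2 + primitive (\<lambda>x. N (u x)) x) has_real_derivative N (u x)) (at x)" for x
    by (auto intro!: derivative_eq_intros primitive_has_derivative[OF Nu])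
  ultimately have "(v has_real_derivative N (u x)) (at x)" for x by simp
  then show thesis using that f_u f'_v u by blast
qed


section \<open>The energy identity\<close>

text \<open>The absolute value keeps the formula valid on both sides of the origin, so the energy
  identity can be derived before the profile is known to be positive.\<close>

lemma abs_powr_has_derivative:
  fixes q s :: real
  assumes "2 \<le> q"
  shows "((\<lambda>s. \<bar>s\<bar> powr q) has_real_derivative q * \<bar>s\<bar> powr (q - 2) * s) (at s)"
proof -
  consider "0 < s" | "s < 0" | "s = 0" by linarith
  then show ?thesis
  proof cases
    case 1
    have "((\<lambda>s. s powr q) has_real_derivative q * s powr (q - 1)) (at s)"
      by (rule has_real_derivative_powr[OF 1])
    also have "s powr (q - 1) = s powr (q - 2) * s"
      using 1 powr_add[of s "q - 2" 1] by simp
    finally have "((\<lambda>s. s powr q) has_real_derivative q * \<bar>s\<bar> powr (q - 2) * s) (at s)"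
      using 1 by (simp add: mult.assoc)
    then show ?thesis
      by (rule has_field_derivative_transform_within_open[where S="{0<..}"]) (use 1 in auto)
  next
    case 2
    have "((\<lambda>s. (- s) powr q) has_real_derivative q * (- s) powr (q - 1) * - 1) (at s)"
      by (rule DERIV_chain2[OF has_real_derivative_powr]) (use 2 in \<open>auto intro!: derivative_eq_intros\<close>)
    also have "(- s) powr (q - 1) = (- s) powr (q - 2) * - s"
      using 2 powr_add[of "- s" "q - 2" 1] by simp
    finally have "((\<lambda>s. (- s) powr q) has_real_derivative q * \<bar>s\<bar> powr (q - 2) * s) (at s)"
      using 2 by (simp add: mult.assoc)
    then show ?thesis
      by (rule has_field_derivative_transform_within_open[where S="{..<0}"]) (use 2 in auto)
  next
    case 3
    have "\<bar>\<bar>h\<bar> powr q / h\<bar> \<le> \<bar>h\<bar>" if "\<bar>h\<bar> \<le> 1" for h :: real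
    proof (cases "h = 0")
      case False
      have "\<bar>h\<bar> powr q \<le> \<bar>h\<bar> powr 2" using that False assms by (intro powr_mono') auto
      then have "\<bar>h\<bar> powr q \<le> \<bar>h\<bar> * \<bar>h\<bar>" using False by (simp add: power2_eq_square)
      with False show ?thesis by (simp add: divide_simps)
    qed simp
    then have "((\<lambda>h. \<bar>h\<bar> powr q / h) \<longlongrightarrow> 0) (at 0)"
      by (intro Lim_null_comparison[OF _ tendsto_rabs_zero[OF tendsto_ident_at]])
         (auto simp: eventually_at dist_real_def intro!: exI[of _ 1])
    with 3 assms show ?thesis by (simp add: DERIV_def)
  qed
qed

text \<open>The right-hand side of the profile equation written as $\varphi'' = N(\varphi)$, where
  \<open>a\<close> stands for $\omega - c^2/4$.\<close>

definition nonlin_force :: "real \<Rightarrow> real \<Rightarrow> real \<Rightarrow> real \<Rightarrow> real \<Rightarrow> real" where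
  "nonlin_force b p a c s = a * s + c / 2 * s ^ 3 - 3 / 16 * s ^ 5 - b * \<bar>s\<bar> powr p * s"

text \<open>The primitive of $2N$ that vanishes at $0$.\<close>

definition energy_potential :: "real \<Rightarrow> real \<Rightarrow> real \<Rightarrow> real \<Rightarrow> real \<Rightarrow> real" where
  "energy_potential b p a c s =
     a * s\<^sup>2 + c / 4 * s ^ 4 - s ^ 6 / 16 - 2 * b / (p + 2) * \<bar>s\<bar> powr (p + 2)"

lemma continuous_nonlin_force: "0 < p \<Longrightarrow> continuous_on UNIV (nonlin_force b p a c)"
proof -
  assume "0 < p"
  then have "continuous_on UNIV (\<lambda>s::real. \<bar>s\<bar> powr p)"
    by (intro continuous_on_powr' continuous_on_rabs continuous_on_id continuous_on_const) auto
  then show ?thesis unfolding nonlin_force_def[abs_def]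
    by (intro continuous_on_diff continuous_on_add continuous_on_mult continuous_on_power
        continuous_on_const continuous_on_id)
qed

lemma energy_potential_has_derivative:
  assumes "0 \<le> p"
  shows "(energy_potential b p a c has_real_derivative 2 * nonlin_force b p a c s) (at s)"
proof -
  have poly: "((\<lambda>s. a * s\<^sup>2 + c / 4 * s ^ 4 - s ^ 6 / 16) has_real_derivative
      2 * (a * s + c / 2 * s ^ 3 - 3 / 16 * s ^ 5)) (at s)"
    by (auto intro!: derivative_eq_intros simp: algebra_simps)
  have powr: "((\<lambda>s. 2 * b / (p + 2) * \<bar>s\<bar> powr (p + 2)) has_real_derivative
      2 * b / (p + 2) * ((p + 2) * \<bar>s\<bar> powr (p + 2 - 2) * s)) (at s)"
    using assms by (intro DERIV_cmult abs_powr_has_derivative) simp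
  have "p + 2 \<noteq> 0" using assms by simp
  then have "2 * b / (p + 2) * ((p + 2) * \<bar>s\<bar> powr (p + 2 - 2) * s) = 2 * (b * \<bar>s\<bar> powr p * s)"
    by simp
  with DERIV_diff[OF poly powr] show ?thesis
    unfolding energy_potential_def[abs_def] nonlin_force_def by (simp add: right_diff_distrib)
qed

lemma left_tail_integral_bounds:
  fixes v :: "real \<Rightarrow> real"
  assumes "integrable lborel v" "\<And>x. 0 \<le> v x"
  shows "0 \<le> (LINT y:{..x}|lborel. v y)" "(LINT y:{..x}|lborel. v y) \<le> (LINT y|lborel. v y)"
proof -
  have int: "integrable lborel (\<lambda>y. indicator {..x} y *\<^sub>R v y)"
    using assms(1) by (intro integrable_mult_indicator) auto
  show "0 \<le> (LINT y:{..x}|lborel. v y)"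
    unfolding set_lebesgue_integral_def using assms(2) by (intro Bochner_Integration.integral_nonneg) auto
  show "(LINT y:{..x}|lborel. v y) \<le> (LINT y|lborel. v y)"
    unfolding set_lebesgue_integral_def
    using assms(2) by (intro integral_mono[OF int assms(1)]) (auto split: split_indicator)
qed

text \<open>Let $D$ be the integral of $u^2 + u'^2$ over the left half-line. Since
  $|2uu'| \le u^2 + u'^2$, the function $u^2 - D$ is nonincreasing and $u^2 + D$ is
  nondecreasing, while $D$ stays between $0$ and the total integral.\<close>

lemma H1_function_bounded:
  fixes u u' :: "real \<Rightarrow> real"
  assumes der: "\<And>x. (u has_real_derivative u' x) (at x)" and cont: "continuous_on UNIV u'"
    and int: "integrable lborel (\<lambda>x. (u x)\<^sup>2)" "integrable lborel (\<lambda>x. (u' x)\<^sup>2)"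
  obtains B where "\<And>x. \<bar>u x\<bar> \<le> B"
proof -
  define v where "v x = (u x)\<^sup>2 + (u' x)\<^sup>2" for x
  have v_int: "integrable lborel v" unfolding v_def[abs_def] using int by simp
  have v_cont: "continuous_on UNIV v"
    unfolding v_def[abs_def] by (intro continuous_intros cont DERIV_continuous_on[OF der])
  have v_nonneg: "0 \<le> v x" for x by (simp add: v_def)
  define D where "D x = (LINT y:{..x}|lborel. v y)" for x
  have D: "0 \<le> D x" "D x \<le> (LINT y|lborel. v y)" for x
    unfolding D_def using left_tail_integral_bounds[OF v_int v_nonneg] by auto
  have D_der: "(D has_real_derivative v x) (at x)" for x
    unfolding D_def[abs_def] by (rule left_tail_integral_has_derivative[OF v_cont v_int])
  have u2_der: "((\<lambda>x. (u x)\<^sup>2) has_real_derivative 2 * u x * u' x) (at x)" for x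
    by (auto intro!: derivative_eq_intros der)
  have amgm: "\<bar>2 * u x * u' x\<bar> \<le> v x" for x
    unfolding v_def using sum_squares_bound[of "u x" "u' x"] sum_squares_bound[of "u x" "- u' x"]
    by (auto simp: abs_le_iff)
  have "(u x)\<^sup>2 \<le> (u 0)\<^sup>2 + (LINT y|lborel. v y)" for x
  proof (cases "0 \<le> x")
    case True
    have "(u x)\<^sup>2 - D x \<le> (u 0)\<^sup>2 - D 0"
    proof (rule DERIV_nonpos_imp_nonincreasing[OF True])
      fix y
      show "\<exists>z. ((\<lambda>x. (u x)\<^sup>2 - D x) has_real_derivative z) (at y) \<and> z \<le> 0"
        using amgm[of y]
        by (intro exI[of _ "2 * u y * u' y - v y"] conjI DERIV_diff[OF u2_der D_der]) (auto simp: abs_le_iff)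
    qed
    with D(1)[of 0] D(2)[of x] show ?thesis by linarith
  next
    case False
    have "(u x)\<^sup>2 + D x \<le> (u 0)\<^sup>2 + D 0"
    proof (rule DERIV_nonneg_imp_nondecreasing[where f="\<lambda>x. (u x)\<^sup>2 + D x"])
      show "x \<le> 0" using False by simp
      fix y
      show "\<exists>z. ((\<lambda>x. (u x)\<^sup>2 + D x) has_real_derivative z) (at y) \<and> 0 \<le> z"
        using amgm[of y]
        by (intro exI[of _ "2 * u y * u' y + v y"] conjI DERIV_add[OF u2_der D_der]) (auto simp: abs_le_iff)
    qed
    with D(1)[of x] D(2)[of 0] show ?thesis by linarith
  qed
  then have "\<bar>u x\<bar> \<le> sqrt ((u 0)\<^sup>2 + (LINT y|lborel. v y))" for x
    by (intro real_le_rsqrt) simp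
  then show thesis by (rule that)
qed

text \<open>A classical solution of the profile equation together with the integrability that it
  inherits from membership in $H^1$.\<close>

locale decaying_profile =
  fixes b p a c :: real and u u' :: "real \<Rightarrow> real"
  assumes b_nonneg: "0 \<le> b" and p_pos: "0 < p"
    and u_der: "\<And>x. (u has_real_derivative u' x) (at x)"
    and u'_der: "\<And>x. (u' has_real_derivative nonlin_force b p a c (u x)) (at x)"
    and u_int: "integrable lborel (\<lambda>x. (u x)\<^sup>2)" and u'_int: "integrable lborel (\<lambda>x. (u' x)\<^sup>2)"
begin

lemma u_cont: "continuous_on UNIV u" and u'_cont: "continuous_on UNIV u'"
  by (rule DERIV_continuous_on[OF u_der], rule DERIV_continuous_on[OF u'_der])

text \<open>The energy $u'^2 - V(u)$ is constant. As \<open>u\<close> is bounded, $|V(u)|$ is at most a multiple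
  of $u^2$, so the energy is integrable over the whole line, and an integrable constant is zero.\<close>

lemma energy: "(u' x)\<^sup>2 = energy_potential b p a c (u x)"
proof -
  define E where "E x = (u' x)\<^sup>2 - energy_potential b p a c (u x)" for x
  have "(E has_real_derivative 2 * u' x * nonlin_force b p a c (u x) - 2 * nonlin_force b p a c (u x) * u' x) (at x)" for x
    unfolding E_def[abs_def] using p_pos
    by (intro DERIV_diff DERIV_chain2[OF energy_potential_has_derivative u_der])
       (auto intro!: derivative_eq_intros u'_der)
  then have "(E has_real_derivative 0) (at x)" for x by (simp add: mult.commute mult.left_commute)
  then have E_const: "E x = E 0" for x using DERIV_isconst_all by blast
  obtain B where B: "\<And>x. \<bar>u x\<bar> \<le> B"
    using H1_function_bounded[OF u_der u'_cont u_int u'_int] by blast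
  have "0 \<le> B" using B[of 0] by linarith
  have "integrable lborel (\<lambda>x. energy_potential b p a c (u x))"
  proof (rule Bochner_Integration.integrable_bound)
    define M where "M = \<bar>a\<bar> + \<bar>c\<bar> / 4 * B ^ 2 + B ^ 4 / 16 + 2 * b / (p + 2) * B powr p"
    show "integrable lborel (\<lambda>x. M * (u x)\<^sup>2)" using u_int by simp
    have "continuous_on UNIV (\<lambda>x. energy_potential b p a c (u x))"
      using DERIV_continuous_on[OF DERIV_chain2[OF energy_potential_has_derivative u_der]] p_pos by auto
    then show "(\<lambda>x. energy_potential b p a c (u x)) \<in> borel_measurable lborel"
      by (simp add: borel_measurable_continuous_onI)
    show "AE x in lborel. norm (energy_potential b p a c (u x)) \<le> norm (M * (u x)\<^sup>2)"
    proof (rule AE_I2)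
      fix x
      let ?s = "u x"
      have "\<bar>?s\<bar> powr (p + 2) = \<bar>?s\<bar> powr p * ?s\<^sup>2"
        by (cases "?s = 0") (auto simp: powr_add)
      then have "energy_potential b p a c ?s =
          (a + c / 4 * ?s\<^sup>2 - ?s ^ 4 / 16 - 2 * b / (p + 2) * \<bar>?s\<bar> powr p) * ?s\<^sup>2"
        unfolding energy_potential_def by (simp only:) (simp add: algebra_simps flip: power_add)
      also have "norm \<dots> = \<bar>a + c / 4 * ?s\<^sup>2 - ?s ^ 4 / 16 - 2 * b / (p + 2) * \<bar>?s\<bar> powr p\<bar> * ?s\<^sup>2"
        by (simp add: abs_mult)
      also have "\<dots> \<le> M * ?s\<^sup>2"
      proof (rule mult_right_mono)
        have "?s ^ 2 \<le> B ^ 2" "?s ^ 4 \<le> B ^ 4"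
          using power_mono[OF B[of x], of 2] power_mono[OF B[of x], of 4] by auto
        then have "\<bar>c / 4 * ?s\<^sup>2\<bar> \<le> \<bar>c\<bar> / 4 * B ^ 2" "\<bar>?s ^ 4 / 16\<bar> \<le> B ^ 4 / 16"
          by (auto simp: abs_mult intro: mult_left_mono)
        moreover have "\<bar>2 * b / (p + 2) * \<bar>?s\<bar> powr p\<bar> \<le> 2 * b / (p + 2) * B powr p"
        proof -
          have "2 * b / (p + 2) * \<bar>?s\<bar> powr p \<le> 2 * b / (p + 2) * B powr p"
            by (intro mult_left_mono powr_mono2) (use B[of x] b_nonneg p_pos in auto)
          moreover have "0 \<le> 2 * b / (p + 2) * \<bar>?s\<bar> powr p" using b_nonneg p_pos by simp
          ultimately show ?thesis by linarith
        qed
        ultimately show "\<bar>a + c / 4 * ?s\<^sup>2 - ?s ^ 4 / 16 - 2 * b / (p + 2) * \<bar>?s\<bar> powr p\<bar> \<le> M"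
          unfolding M_def by linarith
      qed simp
      also have "\<dots> \<le> norm (M * ?s\<^sup>2)" by simp
      finally show "norm (energy_potential b p a c ?s) \<le> norm (M * ?s\<^sup>2)" .
    qed
  qed
  with u'_int have "integrable lborel E" unfolding E_def[abs_def] by simp
  moreover have "E = (\<lambda>_. E 0)" using E_const by (rule ext)
  ultimately have "integrable lborel (\<lambda>_::real. E 0)" by (rule back_subst)
  then have "E 0 = 0" by (simp add: integrable_iff_bounded ennreal_mult_less_top)
  with E_const[of x] show ?thesis by (simp add: E_def)
qed

end


section \<open>Bounds for negative speed\<close>

text \<open>For negative \<open>c\<close> every term of the potential except $a u^2$ is nonpositive, which is
  the source of all the bounds below.\<close>

locale focusing_profile = decaying_profile +
  assumes c_neg: "c < 0" and u_pos_AE: "AE x in lborel. 0 < u x"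
begin

lemma energy_le: "(u' x)\<^sup>2 \<le> a * (u x)\<^sup>2 + c / 4 * u x ^ 4"
proof -
  have "0 \<le> 2 * b / (p + 2) * \<bar>u x\<bar> powr (p + 2)" using b_nonneg p_pos by simp
  moreover have "0 \<le> u x ^ 6 / 16" by simp
  ultimately show ?thesis unfolding energy energy_potential_def by linarith
qed

lemma deriv_le: "(u' x)\<^sup>2 \<le> a * (u x)\<^sup>2"
proof -
  have "c / 4 * u x ^ 4 \<le> 0" using c_neg by (simp add: mult_nonpos_nonneg)
  with energy_le[of x] show ?thesis by linarith
qed

lemma a_nonneg: "0 \<le> a"
proof -
  obtain x where "0 < u x" using AE_imp_ex_in_interval[OF u_pos_AE, of 0 1] by auto
  then have "0 < (u x)\<^sup>2" by simp
  moreover have "0 \<le> a * (u x)\<^sup>2" using order_trans[OF zero_le_power2 deriv_le] .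
  ultimately show ?thesis by (simp add: zero_le_mult_iff)
qed

lemma abs_deriv_le: "0 \<le> u x \<Longrightarrow> \<bar>u' x\<bar> \<le> sqrt a * u x"
  using real_sqrt_le_mono[OF deriv_le[of x]] by (simp add: real_sqrt_mult)

lemma u_nonneg: "0 \<le> u x"
proof -
  have "AE x in lborel. u x \<in> {0..}" using u_pos_AE by eventually_elim simp
  then have "u x \<in> {0..}" by (rule closed_AE_imp_all[OF _ u_cont closed_atLeast])
  then show ?thesis by simp
qed

text \<open>From $|u'| \le \sqrt a\,u$ the function $u\,e^{\sqrt a\,x}$ is nondecreasing, so a positive value
  at one point persists to the right, and almost every point further left has such a value.\<close>

lemma u_pos: "0 < u x"
proof -
  obtain y where y: "y < x" "0 < u y" using AE_imp_ex_in_interval[OF u_pos_AE, of "x - 1" x] by auto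
  have "u y * exp (sqrt a * y) \<le> u x * exp (sqrt a * x)"
  proof (rule DERIV_nonneg_imp_nondecreasing[where f="\<lambda>x. u x * exp (sqrt a * x)"])
    show "y \<le> x" using y by simp
    fix t
    have "((\<lambda>x. u x * exp (sqrt a * x)) has_real_derivative (u' t + sqrt a * u t) * exp (sqrt a * t)) (at t)"
      by (auto intro!: derivative_eq_intros u_der simp: algebra_simps)
    moreover have "0 \<le> (u' t + sqrt a * u t) * exp (sqrt a * t)"
      using abs_deriv_le[OF u_nonneg[of t]] by (intro mult_nonneg_nonneg) auto
    ultimately show "\<exists>z. ((\<lambda>x. u x * exp (sqrt a * x)) has_real_derivative z) (at t) \<and> 0 \<le> z" by blast
  qed
  moreover have "0 < u y * exp (sqrt a * y)" using y by simp
  ultimately have "0 < u x * exp (sqrt a * x)" by linarith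
  then show ?thesis by (simp add: zero_less_mult_iff)
qed

text \<open>The right-hand side of the energy bound must be nonnegative; divide it by $u^2$.\<close>

lemma u_square_le: "(u x)\<^sup>2 \<le> 4 * a / - c"
proof -
  have "u x ^ 4 = (u x)\<^sup>2 * (u x)\<^sup>2" by (simp flip: power_add)
  then have "0 \<le> (a + c / 4 * (u x)\<^sup>2) * (u x)\<^sup>2"
    using order_trans[OF zero_le_power2 energy_le[of x]] by (simp add: algebra_simps)
  then have "0 \<le> a + c / 4 * (u x)\<^sup>2" using u_pos[of x] by (simp add: zero_le_mult_iff)
  then show ?thesis using c_neg by (simp add: field_simps)
qed

text \<open>The derivative of $w = u'/u$ is $(u\,N(u) - V(u))/u^2$ by the energy identity. The
  contributions of the linear term cancel, and those of the quintic and the power term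
  are nonpositive.\<close>

lemma log_deriv_has_derivative_le:
  "\<exists>d. ((\<lambda>x. u' x / u x) has_real_derivative d) (at x) \<and> d \<le> c / 4 * (u x)\<^sup>2"
proof (intro exI conjI)
  have u: "u x \<noteq> 0" using u_pos[of x] by simp
  show "((\<lambda>x. u' x / u x) has_real_derivative
      (nonlin_force b p a c (u x) * u x - u' x * u' x) / (u x * u x)) (at x)"
    by (rule DERIV_divide[OF u'_der u_der u])
  let ?s = "u x"
  have powr: "\<bar>?s\<bar> powr (p + 2) = \<bar>?s\<bar> powr p * ?s\<^sup>2"
    using u_pos[of x] by (simp add: powr_add)
  have "nonlin_force b p a c ?s * ?s - u' x * u' x
      = c / 4 * ?s ^ 4 - ?s ^ 6 / 8 - (b - 2 * b / (p + 2)) * (\<bar>?s\<bar> powr p * ?s\<^sup>2)"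
    using energy[of x] unfolding energy_potential_def nonlin_force_def powr
    by (simp add: power2_eq_square power4_eq_xxxx power3_eq_cube algebra_simps eval_nat_numeral)
  also have "\<dots> \<le> c / 4 * ?s ^ 4"
  proof -
    have "2 * b / (p + 2) \<le> b" using b_nonneg p_pos by (simp add: field_simps)
    then have "0 \<le> (b - 2 * b / (p + 2)) * (\<bar>?s\<bar> powr p * ?s\<^sup>2)" by simp
    moreover have "0 \<le> ?s ^ 6" by simp
    ultimately show ?thesis by linarith
  qed
  finally have "(nonlin_force b p a c ?s * ?s - u' x * u' x) / (?s * ?s) \<le> (c / 4 * ?s ^ 4) / (?s * ?s)"
    by (rule divide_right_mono) simp
  also have "\<dots> = c / 4 * ?s\<^sup>2" using u by (simp add: power2_eq_square power4_eq_xxxx)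
  finally show "(nonlin_force b p a c ?s * ?s - u' x * u' x) / (?s * ?s) \<le> c / 4 * ?s\<^sup>2" .
qed

lemma abs_log_deriv_le: "\<bar>u' x / u x\<bar> \<le> sqrt a"
  using abs_deriv_le[OF u_nonneg, of x] u_pos[of x] by (simp add: divide_le_eq abs_divide)

text \<open>Integrate $-\frac{c}{4} u^2 \le -w'$ with $w = u'/u$: the left side becomes a multiple of the
  mass, while $|w| \le \sqrt a$ bounds the right side by $2\sqrt a$ on every interval.\<close>

lemma mass_le: "(LINT x|lborel. (u x)\<^sup>2) \<le> 8 * sqrt a / - c"
proof -
  define D where "D x = (LINT y:{..x}|lborel. (u y)\<^sup>2)" for x
  have cont: "continuous_on UNIV (\<lambda>x. (u x)\<^sup>2)" by (intro continuous_on_power u_cont)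
  have D_der: "(D has_real_derivative (u x)\<^sup>2) (at x)" for x
    unfolding D_def[abs_def] by (rule left_tail_integral_has_derivative[OF cont u_int])
  have "(LINT t:{x..y}|lborel. (u t)\<^sup>2) \<le> 8 * sqrt a / - c" if "x \<le> y" for x y
  proof -
    have "u' y / u y - c / 4 * D y \<le> u' x / u x - c / 4 * D x"
    proof (rule DERIV_nonpos_imp_nonincreasing[OF that, where f="\<lambda>x. u' x / u x - c / 4 * D x"])
      fix t
      obtain d where d: "((\<lambda>x. u' x / u x) has_real_derivative d) (at t)" "d \<le> c / 4 * (u t)\<^sup>2"
        using log_deriv_has_derivative_le by blast
      show "\<exists>z. ((\<lambda>x. u' x / u x - c / 4 * D x) has_real_derivative z) (at t) \<and> z \<le> 0"
        using d(2) by (intro exI[of _ "d - c / 4 * (u t)\<^sup>2"] conjI DERIV_diff[OF d(1)] DERIV_cmult D_der) simp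
    qed
    then have "(- c / 4) * (D y - D x) \<le> 2 * sqrt a"
      using abs_log_deriv_le[of x] abs_log_deriv_le[of y] unfolding abs_le_iff left_diff_distrib right_diff_distrib
      by linarith
    then have "D y - D x \<le> 8 * sqrt a / - c" using c_neg by (simp add: field_simps)
    moreover have "(LINT t:{x..y}|lborel. (u t)\<^sup>2) = D y - D x"
      unfolding set_lebesgue_integral_def
      using integral_FTC_Icc_real[OF that D_der] cont
      by (simp add: continuous_on_eq_continuous_at mult.commute)
    ultimately show ?thesis by simp
  qed
  then have "\<forall>\<^sub>F x in at_bot. (LINT t:{x..y}|lborel. (u t)\<^sup>2) \<le> 8 * sqrt a / - c" for y
    by (rule eventually_mono[OF eventually_le_at_bot])
  moreover have "((\<lambda>x. LINT t:{x..y}|lborel. (u t)\<^sup>2) \<longlongrightarrow> D y) at_bot" for y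
    unfolding D_def set_integrable_def
    using u_int by (intro tendsto_set_lebesgue_integral_at_bot)
      (auto simp: set_integrable_def intro!: integrable_mult_indicator[where f="\<lambda>x. (u x)\<^sup>2", simplified])
  ultimately have "D y \<le> 8 * sqrt a / - c" for y
    using tendsto_upperbound trivial_limit_at_bot_linorder by blast
  moreover have "(D \<longlongrightarrow> (LINT x|lborel. (u x)\<^sup>2)) at_top"
    unfolding D_def[abs_def] set_lebesgue_integral_def
    using u_int by (intro tendsto_integral_at_top) auto
  ultimately show ?thesis
    by (intro tendsto_upperbound[OF _ _ trivial_limit_at_top_linorder] always_eventually) auto
qed

text \<open>The integrands of the second integral are bounded pointwise by a multiple of $u^2$,
  through $u'^2 \le a u^2$ and the pointwise bound $u^2 \le 4a/(-c)$.\<close>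

lemma H1_mass_le:
  "(LINT x|lborel. (u x)\<^sup>2) + (LINT x|lborel. (u' x)\<^sup>2 + (u x * (c / 2 - (u x)\<^sup>2 / 4))\<^sup>2)
     \<le> 8 * sqrt a / - c * (1 + a + (- c / 2 + a / - c)\<^sup>2)"
proof -
  define K where "K = a + (- c / 2 + a / - c)\<^sup>2"
  have pointwise: "(u' x)\<^sup>2 + (u x * (c / 2 - (u x)\<^sup>2 / 4))\<^sup>2 \<le> K * (u x)\<^sup>2" for x
  proof -
    have "\<bar>c / 2 - (u x)\<^sup>2 / 4\<bar> \<le> - c / 2 + a / - c"
    proof -
      have "(u x)\<^sup>2 / 4 \<le> a / - c"
        using u_square_le[of x] unfolding times_divide_eq_right[symmetric] by linarith
      moreover have "0 \<le> a / - c" using a_nonneg c_neg by (simp add: divide_nonneg_neg)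
      ultimately show ?thesis using c_neg zero_le_power2[of "u x"] unfolding abs_le_iff by linarith
    qed
    then have "(c / 2 - (u x)\<^sup>2 / 4)\<^sup>2 \<le> (- c / 2 + a / - c)\<^sup>2"
      by (metis abs_ge_zero power2_abs power_mono)
    then have "(u x)\<^sup>2 * (c / 2 - (u x)\<^sup>2 / 4)\<^sup>2 \<le> (u x)\<^sup>2 * (- c / 2 + a / - c)\<^sup>2"
      by (rule mult_left_mono) simp
    with deriv_le[of x] show ?thesis unfolding K_def power_mult_distrib distrib_right
      by (simp add: mult.commute)
  qed
  have "0 \<le> K" using a_nonneg by (simp add: K_def)
  have "(LINT x|lborel. (u' x)\<^sup>2 + (u x * (c / 2 - (u x)\<^sup>2 / 4))\<^sup>2) \<le> (LINT x|lborel. K * (u x)\<^sup>2)"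
    using u_int pointwise \<open>0 \<le> K\<close> by (intro integral_mono') auto
  then have "(LINT x|lborel. (u x)\<^sup>2) + (LINT x|lborel. (u' x)\<^sup>2 + (u x * (c / 2 - (u x)\<^sup>2 / 4))\<^sup>2)
      \<le> (LINT x|lborel. (u x)\<^sup>2) * (1 + K)"
    by (simp add: algebra_simps)
  also have "\<dots> \<le> 8 * sqrt a / - c * (1 + K)"
    using mass_le \<open>0 \<le> K\<close> by (intro mult_right_mono) auto
  finally show ?thesis by (simp add: K_def add.assoc)
qed

end


section \<open>The gauge transformation and the limit\<close>

lemma locally_integrable_measurable:
  fixes f :: "real \<Rightarrow> 'a::euclidean_space"
  assumes "locally_integrable f"
  shows "f \<in> borel_measurable borel"
proof (rule borel_measurable_LIMSEQ_metric)
  fix n :: nat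
  have "integrable lborel (\<lambda>x. indicator {- real n..real n} x *\<^sub>R f x)"
    using assms by (simp add: locally_integrable_def set_integrable_def)
  then show "(\<lambda>x. indicator {- real n..real n} x *\<^sub>R f x) \<in> borel_measurable borel"
    using borel_measurable_integrable by fastforce
next
  fix x :: real
  obtain n0 where "\<bar>x\<bar> \<le> real n0" using real_arch_simple by blast
  then have "indicator {- real n..real n} x *\<^sub>R f x = f x" if "n0 \<le> n" for n
    using that by (auto simp: indicator_def abs_le_iff)
  then show "(\<lambda>n. indicator {- real n..real n} x *\<^sub>R f x) \<longlonglongrightarrow> f x"
    by (intro tendsto_eventually) (auto simp: eventually_sequentially)
qed

text \<open>Any weak derivative may be used to compute the norm, because two of them agree almost
  everywhere.\<close>

lemma H1_norm_eq:
  fixes f g :: "real \<Rightarrow> 'a::euclidean_space"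
  assumes fg: "has_weak_deriv f g"
  shows "H1_norm f = sqrt ((LINT x|lborel. (norm (f x))\<^sup>2) + (LINT x|lborel. (norm (g x))\<^sup>2))"
proof -
  have wd: "has_weak_deriv f (weak_deriv f)"
    unfolding weak_deriv_def using fg by (rule someI[of "has_weak_deriv f"])
  have [measurable]: "weak_deriv f \<in> borel_measurable borel" "g \<in> borel_measurable borel"
    using wd fg by (auto simp: has_weak_deriv_def intro: locally_integrable_measurable)
  have "AE x in lborel. weak_deriv f x = g x" by (rule weak_deriv_unique_AE[OF wd fg]) simp
  then have "(LINT x|lborel. (norm (weak_deriv f x))\<^sup>2) = (LINT x|lborel. (norm (g x))\<^sup>2)"
    by (intro integral_cong_AE) auto
  then show ?thesis by (simp add: H1_norm_def)
qed

context decaying_profile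
begin

lemma gauge_term_integrable: "integrable lborel (\<lambda>x. (u x * (c / 2 - (u x)\<^sup>2 / 4))\<^sup>2)"
proof -
  obtain B where B: "\<And>x. \<bar>u x\<bar> \<le> B"
    using H1_function_bounded[OF u_der u'_cont u_int u'_int] by blast
  show ?thesis
  proof (rule Bochner_Integration.integrable_bound)
    show "integrable lborel (\<lambda>x. (\<bar>c\<bar> / 2 + B\<^sup>2 / 4)\<^sup>2 * (u x)\<^sup>2)" using u_int by simp
    have "continuous_on UNIV (\<lambda>x. (u x * (c / 2 - (u x)\<^sup>2 / 4))\<^sup>2)"
      by (intro continuous_intros u_cont) simp
    then show "(\<lambda>x. (u x * (c / 2 - (u x)\<^sup>2 / 4))\<^sup>2) \<in> borel_measurable lborel"
      by (simp add: borel_measurable_continuous_onI)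
    show "AE x in lborel. norm ((u x * (c / 2 - (u x)\<^sup>2 / 4))\<^sup>2) \<le> norm ((\<bar>c\<bar> / 2 + B\<^sup>2 / 4)\<^sup>2 * (u x)\<^sup>2)"
    proof (rule AE_I2)
      fix x
      have "(u x)\<^sup>2 \<le> B\<^sup>2" using power_mono[OF B[of x], of 2] by simp
      then have "\<bar>c / 2 - (u x)\<^sup>2 / 4\<bar> \<le> \<bar>c\<bar> / 2 + B\<^sup>2 / 4"
        using zero_le_power2[of "u x"] by linarith
      then have "\<bar>c / 2 - (u x)\<^sup>2 / 4\<bar>\<^sup>2 \<le> (\<bar>c\<bar> / 2 + B\<^sup>2 / 4)\<^sup>2" by (rule power_mono) simp
      then have "(u x)\<^sup>2 * (c / 2 - (u x)\<^sup>2 / 4)\<^sup>2 \<le> (u x)\<^sup>2 * (\<bar>c\<bar> / 2 + B\<^sup>2 / 4)\<^sup>2"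
        by (intro mult_left_mono) auto
      then show "norm ((u x * (c / 2 - (u x)\<^sup>2 / 4))\<^sup>2) \<le> norm ((\<bar>c\<bar> / 2 + B\<^sup>2 / 4)\<^sup>2 * (u x)\<^sup>2)"
        by (simp add: power_mult_distrib abs_mult mult.commute)
    qed
  qed
qed

text \<open>With $\theta' = c/2 - u^2/4$ the gauged profile is $u\,e^{i\theta}$ almost everywhere, a
  continuously differentiable function with derivative $(u' + i\,u\,\theta')\,e^{i\theta}$. The
  phase has modulus one, so the norms only see $u$, $u'$ and $u\,\theta'$.\<close>

lemma gauged_profile_H1:
  assumes \<phi>: "\<phi> \<in> borel_measurable borel" and eq: "AE x in lborel. \<phi> x = u x"
  shows "gauged_profile c \<phi> \<in> H1"
    and "H1_norm (gauged_profile c \<phi>) = sqrt ((LINT x|lborel. (u x)\<^sup>2)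
      + (LINT x|lborel. (u' x)\<^sup>2 + (u x * (c / 2 - (u x)\<^sup>2 / 4))\<^sup>2))"
proof -
  define D where "D x = (LINT y:{..x}|lborel. (u y)\<^sup>2)" for x
  define \<theta> where "\<theta> x = c / 2 * x - D x / 4" for x
  define phase where "phase x = exp (\<i> * complex_of_real (\<theta> x))" for x
  define U' where "U' x = Complex (u' x) (u x * (c / 2 - (u x)\<^sup>2 / 4)) * phase x" for x
  have D_der: "(D has_real_derivative (u x)\<^sup>2) (at x)" for x
    unfolding D_def[abs_def]
    by (rule left_tail_integral_has_derivative[OF continuous_on_power[OF u_cont] u_int])
  have \<theta>_der: "(\<theta> has_real_derivative c / 2 - (u x)\<^sup>2 / 4) (at x)" for x
    unfolding \<theta>_def[abs_def] by (auto intro!: derivative_eq_intros D_der)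
  have \<theta>_cont: "continuous_on UNIV \<theta>" by (rule DERIV_continuous_on[OF \<theta>_der])
  have phase_cont: "continuous_on UNIV phase"
    unfolding phase_def[abs_def] by (intro continuous_intros \<theta>_cont)
  have norm_phase: "norm (phase x) = 1" for x by (simp add: phase_def norm_exp_i_times)
  have phase_der: "(phase has_vector_derivative
      (\<i> * complex_of_real (c / 2 - (u x)\<^sup>2 / 4)) * phase x) (at x)" for x
  proof -
    have "((\<lambda>x. \<i> * complex_of_real (\<theta> x)) has_vector_derivative
        \<i> * complex_of_real (c / 2 - (u x)\<^sup>2 / 4)) (at x)"
      by (intro has_vector_derivative_mult_right has_vector_derivative_of_real \<theta>_der)
    from field_vector_diff_chain_at[OF this DERIV_exp]
    show ?thesis by (simp add: phase_def[abs_def] o_def)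
  qed
  have U_der: "((\<lambda>x. complex_of_real (u x) * phase x) has_vector_derivative U' x) (at x)" for x
  proof -
    have "((\<lambda>x. complex_of_real (u x)) has_vector_derivative complex_of_real (u' x)) (at x)"
      by (intro has_vector_derivative_of_real u_der)
    from has_vector_derivative_mult[OF this phase_der]
    have "((\<lambda>x. complex_of_real (u x) * phase x) has_vector_derivative
      complex_of_real (u x) * (\<i> * complex_of_real (c / 2 - (u x)\<^sup>2 / 4) * phase x)
      + complex_of_real (u' x) * phase x) (at x)" .
    also have "complex_of_real (u x) * (\<i> * complex_of_real (c / 2 - (u x)\<^sup>2 / 4) * phase x)
      + complex_of_real (u' x) * phase x = U' x"
      by (simp add: U'_def Complex_eq algebra_simps)
    finally show ?thesis .
  qed
  have U'_cont: "continuous_on UNIV U'"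
    unfolding U'_def[abs_def] Complex_eq
    by (intro continuous_intros u_cont u'_cont phase_cont) simp
  have D_\<phi>: "(LINT y:{..x}|lborel. \<bar>\<phi> y\<bar>\<^sup>2) = D x" for x
    unfolding D_def
  proof (rule set_lebesgue_integral_cong_AE)
    show "AE y\<in>{..x} in lborel. \<bar>\<phi> y\<bar>\<^sup>2 = (u y)\<^sup>2" using eq by eventually_elim simp
    show "(\<lambda>y. (u y)\<^sup>2) \<in> borel_measurable lborel" using u_int by blast
  qed (use \<phi> in simp_all)
  have gauged: "gauged_profile c \<phi> = (\<lambda>x. complex_of_real (\<phi> x) * phase x)"
    unfolding gauged_profile_def[abs_def] D_\<phi> phase_def \<theta>_def by (simp add: algebra_simps)
  have meas: "gauged_profile c \<phi> \<in> borel_measurable borel"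
  proof -
    have [measurable]: "phase \<in> borel_measurable borel"
      by (rule borel_measurable_continuous_onI[OF phase_cont])
    note \<phi>[measurable]
    show ?thesis unfolding gauged by measurable
  qed
  have weak: "has_weak_deriv (gauged_profile c \<phi>) U'"
    using meas _ U_der U'_cont
  proof (rule has_weak_deriv_classical)
    show "AE x in lborel. gauged_profile c \<phi> x = complex_of_real (u x) * phase x"
      using eq unfolding gauged by eventually_elim simp
  qed
  have norm_gauged: "AE x in lborel. (norm (gauged_profile c \<phi> x))\<^sup>2 = (u x)\<^sup>2"
    using eq unfolding gauged by eventually_elim (simp add: norm_mult norm_phase)
  have norm_U': "(norm (U' x))\<^sup>2 = (u' x)\<^sup>2 + (u x * (c / 2 - (u x)\<^sup>2 / 4))\<^sup>2" for x
    by (simp add: U'_def norm_mult norm_phase cmod_power2)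
  have meas2: "(\<lambda>x. (norm (gauged_profile c \<phi> x))\<^sup>2) \<in> borel_measurable lborel"
    using meas by simp
  have "integrable lborel (\<lambda>x. (norm (gauged_profile c \<phi> x))\<^sup>2)"
    by (rule integrable_cong_AE_imp[OF u_int meas2]) (use norm_gauged in \<open>eventually_elim, simp\<close>)
  then have "square_integrable (gauged_profile c \<phi>)"
    using meas by (simp add: square_integrable_def)
  moreover have "square_integrable U'"
    unfolding square_integrable_def norm_U'
    using U'_cont u'_int gauge_term_integrable by (simp add: borel_measurable_continuous_onI)
  ultimately show "gauged_profile c \<phi> \<in> H1" using weak by (auto simp: H1_def)
  have "(LINT x|lborel. (norm (gauged_profile c \<phi> x))\<^sup>2) = (LINT x|lborel. (u x)\<^sup>2)"
    using norm_gauged meas2 u_int by (intro integral_cong_AE) auto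
  then show "H1_norm (gauged_profile c \<phi>) = sqrt ((LINT x|lborel. (u x)\<^sup>2)
      + (LINT x|lborel. (u' x)\<^sup>2 + (u x * (c / 2 - (u x)\<^sup>2 / 4))\<^sup>2))"
    by (simp add: H1_norm_eq[OF weak] norm_U')
qed

end

text \<open>The square integrable derivative provided by $H^1$ and the derivative in the equation
  are a priori different functions; uniqueness of weak derivatives identifies them.\<close>

lemma positive_even_profile_classical:
  assumes prof: "positive_even_profile b p \<omega> c \<phi>" and "0 \<le> b" "0 < p"
  obtains u u' where "decaying_profile b p (\<omega> - c\<^sup>2 / 4) c u u'"
    "AE x in lborel. \<phi> x = u x" "AE x in lborel. 0 < u x" "\<phi> \<in> borel_measurable borel"
proof -
  let ?a = "\<omega> - c\<^sup>2 / 4"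
  from prof have H1: "\<phi> \<in> H1" and pos: "AE x in lborel. 0 < \<phi> x"
    unfolding positive_even_profile_def by blast+
  from prof obtain \<phi>' \<phi>'' where w: "has_weak_deriv \<phi> \<phi>'" "has_weak_deriv \<phi>' \<phi>''"
    and eqn: "AE x in lborel. - \<phi>'' x + ?a * \<phi> x + c / 2 * \<bar>\<phi> x\<bar>\<^sup>2 * \<phi> x
             - 3 / 16 * \<bar>\<phi> x\<bar> ^ 4 * \<phi> x - b * \<bar>\<phi> x\<bar> powr p * \<phi> x = 0"
    unfolding positive_even_profile_def by blast
  have "AE x in lborel. \<phi>'' x = nonlin_force b p ?a c (\<phi> x)"
    using eqn by eventually_elim (simp add: nonlin_force_def eval_nat_numeral algebra_simps)
  from weak_second_order_solution_classical[OF w this continuous_nonlin_force[OF \<open>0 < p\<close>]]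
  obtain u u' where u: "AE x in lborel. \<phi> x = u x" "AE x in lborel. \<phi>' x = u' x"
    "\<And>x. (u has_real_derivative u' x) (at x)"
    "\<And>x. (u' has_real_derivative nonlin_force b p ?a c (u x)) (at x)" by blast
  have meas: "\<phi> \<in> borel_measurable borel" and L2: "integrable lborel (\<lambda>x. (norm (\<phi> x))\<^sup>2)"
    using H1 by (auto simp: H1_def square_integrable_def)
  obtain g where g: "has_weak_deriv \<phi> g" "integrable lborel (\<lambda>x. (norm (g x))\<^sup>2)"
    using H1 by (auto simp: H1_def square_integrable_def)
  have "AE x in lborel. g x = \<phi>' x" by (rule weak_deriv_unique_AE[OF g(1) w(1)]) simp
  with u(2) have g_u': "AE x in lborel. g x = u' x" by eventually_elim simp
  have cont: "continuous_on UNIV u" "continuous_on UNIV u'"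
    by (rule DERIV_continuous_on[OF u(3)], rule DERIV_continuous_on[OF u(4)])
  have "integrable lborel (\<lambda>x. (u x)\<^sup>2)"
  proof (rule integrable_cong_AE_imp[OF L2])
    show "(\<lambda>x. (u x)\<^sup>2) \<in> borel_measurable lborel"
      using borel_measurable_continuous_onI[OF cont(1)] by simp
    show "AE x in lborel. (norm (\<phi> x))\<^sup>2 = (u x)\<^sup>2" using u(1) by eventually_elim simp
  qed
  moreover have "integrable lborel (\<lambda>x. (u' x)\<^sup>2)"
  proof (rule integrable_cong_AE_imp[OF g(2)])
    show "(\<lambda>x. (u' x)\<^sup>2) \<in> borel_measurable lborel"
      using borel_measurable_continuous_onI[OF cont(2)] by simp
    show "AE x in lborel. (norm (g x))\<^sup>2 = (u' x)\<^sup>2" using g_u' by eventually_elim simp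
  qed
  ultimately have "decaying_profile b p ?a c u u'"
    using u(3,4) \<open>0 \<le> b\<close> \<open>0 < p\<close> by unfold_locales
  moreover have "AE x in lborel. 0 < u x" using pos u(1) by eventually_elim simp
  ultimately show thesis using that u(1) meas by blast
qed

theorem lemma1p5:
  fixes b p \<omega> :: real and \<phi> :: "real \<Rightarrow> real \<Rightarrow> real"
  assumes "b \<ge> 0" and "p \<ge> 4" and "\<omega> > 0"
    and "\<And>c. 4 * \<omega> > c\<^sup>2 \<Longrightarrow> positive_even_profile b p \<omega> c (\<phi> c)"
  shows "(\<forall>c. 4 * \<omega> > c\<^sup>2 \<longrightarrow> gauged_profile c (\<phi> c) \<in> H1) \<and>
    ((\<lambda>c. H1_norm (gauged_profile c (\<phi> c))) \<longlongrightarrow> 0)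
       (at (- 2 * sqrt \<omega>) within {- 2 * sqrt \<omega><..<2 * sqrt \<omega>})"
proof (intro conjI allI impI)
  have "0 < p" using assms(2) by simp
  note classical = positive_even_profile_classical[OF assms(4) assms(1) \<open>0 < p\<close>]
  show "gauged_profile c (\<phi> c) \<in> H1" if c: "4 * \<omega> > c\<^sup>2" for c
  proof -
    obtain u u' where "decaying_profile b p (\<omega> - c\<^sup>2 / 4) c u u'"
      "AE x in lborel. \<phi> c x = u x" "\<phi> c \<in> borel_measurable borel"
      using classical[OF c] by blast
    then show ?thesis using decaying_profile.gauged_profile_H1(1) by blast
  qed
  let ?c0 = "- 2 * sqrt \<omega>"
  let ?F = "at ?c0 within {?c0<..<2 * sqrt \<omega>}"
  define bound where "bound c = sqrt (8 * sqrt (\<omega> - c\<^sup>2 / 4) / - c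
      * (1 + (\<omega> - c\<^sup>2 / 4) + (- c / 2 + (\<omega> - c\<^sup>2 / 4) / - c)\<^sup>2))" for c
  \<comment> \<open>\<open>bound\<close> vanishes at the end point because \<open>\<omega> - c\<^sup>2 / 4\<close> does; near it \<open>c\<close> is negative\<close>
  have le: "H1_norm (gauged_profile c (\<phi> c)) \<le> bound c" if "c \<in> {?c0<..<2 * sqrt \<omega>}" "c < 0" for c
  proof -
    have "\<bar>c\<bar> < 2 * sqrt \<omega>" using that by auto
    then have "\<bar>c\<bar>\<^sup>2 < (2 * sqrt \<omega>)\<^sup>2" by (intro power_strict_mono) auto
    then have c: "4 * \<omega> > c\<^sup>2" using assms(3) by (simp add: power_mult_distrib)
    obtain u u' where u: "decaying_profile b p (\<omega> - c\<^sup>2 / 4) c u u'"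
      "AE x in lborel. \<phi> c x = u x" "AE x in lborel. 0 < u x" "\<phi> c \<in> borel_measurable borel"
      using classical[OF c] by blast
    then have "focusing_profile b p (\<omega> - c\<^sup>2 / 4) c u u'"
      using \<open>c < 0\<close> by (simp add: focusing_profile_def focusing_profile_axioms_def)
    from focusing_profile.H1_mass_le[OF this] show ?thesis
      unfolding decaying_profile.gauged_profile_H1(2)[OF u(1,4,2)] bound_def
      by (rule real_sqrt_le_mono)
  qed
  have "0 < sqrt \<omega>" using assms(3) by simp
  have zero: "bound ?c0 = 0" using assms(3) by (simp add: bound_def power_mult_distrib)
  have "isCont bound ?c0"
    unfolding bound_def[abs_def] using \<open>0 < sqrt \<omega>\<close> by (intro continuous_intros) auto
  then have lim: "(bound \<longlongrightarrow> 0) ?F"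
    unfolding isCont_def zero by (rule tendsto_mono[OF at_le, rotated]) simp
  have ev: "\<forall>\<^sub>F c in ?F. c \<in> {?c0<..<2 * sqrt \<omega>} \<and> c < 0"
    using \<open>0 < sqrt \<omega>\<close>
    by (auto simp: eventually_at dist_real_def intro!: exI[of _ "2 * sqrt \<omega>"])
  show "((\<lambda>c. H1_norm (gauged_profile c (\<phi> c))) \<longlongrightarrow> 0) ?F"
  proof (rule tendsto_sandwich[OF _ _ tendsto_const lim])
    show "\<forall>\<^sub>F c in ?F. 0 \<le> H1_norm (gauged_profile c (\<phi> c))"
      by (simp add: H1_norm_def)
    show "\<forall>\<^sub>F c in ?F. H1_norm (gauged_profile c (\<phi> c)) \<le> bound c"
      using ev by eventually_elim (use le in blast)
  qed
qed

end
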